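(* Let $K\subset\mathbb{R}^d$ ($d\geq 1$) be a closed convex cone with non-empty interior $K^{o}$, let $v\in K^{o}$ be a fixed vector, and let $\mu$ be a probability measure on $\mathbb{R}^d$ such that: (i) the support of $\mu$ is not included in any linear hyperplane of $\mathbb{R}^d$; (ii) there exist a point $x^*\in K^*$ and an open neighborhood $V$ of $x^*$ in $\mathbb{R}^d$ such that $L_\mu(x)<\infty$ for all $x\in V$, and $x^*$ is a minimum point of $L_\mu$ restricted to $K^*\cap V$. Let $\delta\geq 0$ be such that there exists $n_0\geq 1$ with $$\mathbb{P}^0_\mu[\tau_{K_{-\delta}}>n_0,\ S_{n_0}\in K^{o}]>0.$$ Then, for all $x\in K_\delta$, $$\lim_{n\to\infty}\mathbb{P}^x_\mu[\tau_K>n]^{1/n}=L_\mu(x^* ).$$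
   Context: $\langle\cdot,\cdot\rangle$ is the standard inner product on $\mathbb{R}^d$. The dual cone of $K$ is $K^*=\{z\in\mathbb{R}^d:\langle x,z\rangle\geq 0\ \forall x\in K\}$. The Laplace transform of $\mu$ is $L_\mu(x)=\int_{\mathbb{R}^d}e^{\langle x,y\rangle}\mu(dy)\in(0,\infty]$. For $\delta\in\mathbb{R}$, $K_\delta=K+\delta v$. Under $\mathbb{P}^x_\mu$, $(S_n)_{n\geq 0}$ is a random walk on $\mathbb{R}^d$ with $S_0=x$ whose increments $S_{n+1}-S_n$ are independent with common distribution $\mu$. For a set $A\subset\mathbb{R}^d$, $\tau_A=\inf\{n\geq 1:S_n\notin A\}$ (with $\inf\emptyset=\infty$). *)

theory Defs
  imports "HOL-Probability.Probability"
begin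

definition dual_cone :: "'a::real_inner set \<Rightarrow> 'a set" where
  "dual_cone K = {z. \<forall>x\<in>K. 0 \<le> x \<bullet> z}"

definition shift_along :: "'a::real_vector set \<Rightarrow> 'a \<Rightarrow> real \<Rightarrow> 'a set" where
  "shift_along K v \<delta> = (\<lambda>x. x + \<delta> *\<^sub>R v) ` K"

definition laplace_transform :: "'a::real_inner measure \<Rightarrow> 'a \<Rightarrow> ennreal" where
  "laplace_transform \<mu> x = (\<integral>\<^sup>+ y. ennreal (exp (x \<bullet> y)) \<partial>\<mu>)"

definition measure_support :: "'a::topological_space measure \<Rightarrow> 'a set" where
  "measure_support \<mu> = {x. \<forall>U. open U \<longrightarrow> x \<in> U \<longrightarrow> 0 < emeasure \<mu> U}"

definition linear_hyperplane :: "'a::euclidean_space set \<Rightarrow> bool" where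
  "linear_hyperplane H \<longleftrightarrow> subspace H \<and> dim H + 1 = DIM('a)"

definition random_walk ::
    "'w measure \<Rightarrow> (nat \<Rightarrow> 'w \<Rightarrow> 'a::euclidean_space) \<Rightarrow> 'a measure \<Rightarrow> 'a \<Rightarrow> bool" where
  "random_walk M S \<mu> x \<longleftrightarrow>
     prob_space M \<and>
     (\<forall>n. S n \<in> borel_measurable M) \<and>
     (AE \<omega> in M. S 0 \<omega> = x) \<and>
     prob_space.indep_vars M (\<lambda>_. borel) (\<lambda>n \<omega>. S (Suc n) \<omega> - S n \<omega>) UNIV \<and>
     (\<forall>n. distr M borel (\<lambda>\<omega>. S (Suc n) \<omega> - S n \<omega>) = \<mu>)"

text \<open>Time \<open>0\<close> is excluded, so a path starting outside \<open>A\<close> need not have exit time \<open>0\<close>;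
  a path that stays in \<open>A\<close> from time \<open>1\<close> on has exit time \<open>Inf {} = \<infinity>\<close>.\<close>

definition exit_time :: "'a set \<Rightarrow> (nat \<Rightarrow> 'a) \<Rightarrow> enat" where
  "exit_time A s = Inf {enat n | n. 1 \<le> n \<and> s n \<notin> A}"

text \<open>The law of the walk on path space realises the walks from all starting points
  simultaneously by one coordinate process.\<close>

lemma random_walk_path_space:
  fixes \<mu> :: "'a::euclidean_space measure"
  assumes "prob_space \<mu>" and sets_\<mu>: "sets \<mu> = sets borel"
  shows "random_walk
           (distr (Pi\<^sub>M UNIV (\<lambda>_::nat. \<mu>)) (Pi\<^sub>M UNIV (\<lambda>_::nat. borel))
              (\<lambda>\<omega> n. x + (\<Sum>i<n. \<omega> i)))
           (\<lambda>n s. s n) \<mu> x"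
proof -
  let ?Q = "Pi\<^sub>M UNIV (\<lambda>_::nat. \<mu>)" and ?N = "Pi\<^sub>M UNIV (\<lambda>_::nat. borel :: 'a measure)"
  let ?f = "\<lambda>\<omega> n. x + (\<Sum>i<n. \<omega> i)"
  interpret mu: prob_space \<mu> by fact
  interpret Q: product_prob_space "\<lambda>_::nat. \<mu>" UNIV ..
  have sets_Q: "sets ?Q = sets ?N"
    by (rule sets_PiM_cong) (simp_all add: sets_\<mu>)
  have f[measurable]: "?f \<in> measurable ?Q ?N"
    unfolding measurable_cong_sets[OF sets_Q refl]
    by (rule measurable_PiM_single') auto
  let ?M = "distr ?Q ?N ?f"
  interpret M: prob_space ?M
    by (rule Q.prob_space_distr) (rule f)
  have inc[measurable]: "(\<lambda>s. s (Suc n) - s n) \<in> borel_measurable ?N" for n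
    by measurable
  have incs: "(\<lambda>s. \<lambda>n\<in>UNIV. s (Suc n) - s n) \<in> measurable ?N ?N"
    by (rule measurable_PiM_single') auto
  have d: "distr ?M borel (\<lambda>s. s (Suc n) - s n) = \<mu>" for n
  proof -
    have "distr ?M borel (\<lambda>s. s (Suc n) - s n) = distr ?Q borel (\<lambda>\<omega>. \<omega> n)"
      by (subst distr_distr[OF inc f]) (simp add: o_def)
    also have "\<dots> = distr ?Q \<mu> (\<lambda>\<omega>. \<omega> n)"
      by (rule distr_cong) (simp_all add: sets_\<mu>)
    also have "\<dots> = \<mu>"
      by (rule Q.PiM_component) simp
    finally show ?thesis .
  qed
  have "distr ?M ?N (\<lambda>s. \<lambda>n\<in>UNIV. s (Suc n) - s n) = distr ?Q ?N (\<lambda>\<omega>. \<omega>)"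
    by (subst distr_distr[OF incs f]) (simp add: o_def restrict_UNIV)
  also have "\<dots> = ?Q"
    using distr_id2[OF sets_Q[symmetric]] by simp
  finally have "M.indep_vars (\<lambda>_. borel) (\<lambda>n s. s (Suc n) - s n) UNIV"
    by (subst M.indep_vars_iff_distr_eq_PiM) (simp_all add: d)
  moreover have "AE s in ?M. s 0 = x"
    by (subst AE_distr_iff[OF f]) (simp_all, measurable)
  ultimately show ?thesis
    unfolding random_walk_def using d M.prob_space_axioms by simp
qed

end

theory Submission
  imports Defs
begin

text \<open>Write \<open>L\<close> for the Laplace transform of the step law and \<open>S\<close> for the walk. The upper bound is
Markov's inequality: \<open>xstar\<close> is nonnegative on \<open>K\<close>, so a walk that starts in \<open>x\<close> and lies in \<open>K\<close> at
time \<open>n\<close> has \<open>exp (xstar \<bullet> S n) \<ge> 1\<close>, and the expectation of this variable is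
\<open>exp (xstar \<bullet> x) * L xstar ^ n\<close> (\<open>prob_stay_upper_bound\<close>).

The lower bound separates the geometry of staying in the cone from the computation of the rate. Suppose
that, for some time \<open>N\<close>, the walk from the origin lies in \<open>K\<close> at time \<open>N\<close> with probability greater
than \<open>q\<close>. With probability still greater than \<open>q\<close> it moreover stays in \<open>K - R v\<close> up to time \<open>N\<close>, for
some \<open>R\<close>. A walk at depth \<open>R\<close> in the cone, that is in \<open>K + R v\<close>, can then perform such a stretch of
\<open>N\<close> steps inside \<open>K\<close> and is again at depth \<open>R\<close> when it ends. So it survives \<open>j N\<close> steps with
probability at least \<open>q ^ j\<close>. The hypothesis on \<open>\<delta>\<close> is what allows a walk from \<open>K + \<delta> v\<close> to reach
depth \<open>R\<close> in the first place, at the price of a constant (\<open>prob_stay_lower_bound\<close>).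

It remains to find times \<open>N\<close> at which \<open>S N\<close> lies in \<open>K\<close> with probability at least
\<open>(L xstar * exp (- t)) ^ N\<close>, for each \<open>t > 0\<close> (\<open>cone_visit_probability\<close>). The natural change of
measure by \<open>exp (xstar \<bullet> y)\<close> produces a drift in \<open>K\<close>, but perhaps on its boundary, where the direct argument
needs a multidimensional central limit theorem. Tilting instead by a point \<open>x\<close> that minimises
\<open>L x - \<epsilon> * (x \<bullet> v)\<close> over the dual cone near \<open>xstar\<close> gives a drift in the interior of \<open>K\<close>
(\<open>exists_tilt_into_cone\<close>), for which the weak law of large numbers suffices (\<open>tilted_weak_law\<close>). Such
a minimum exists close to \<open>xstar\<close> because \<open>L\<close> is strictly convex, which is exactly the non-degeneracy
of the support; and the minimality of \<open>xstar\<close> gives \<open>L x \<ge> L xstar\<close>, so that only the cost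
\<open>exp (- N * (x \<bullet> m))\<close> of the drift \<open>m\<close> is lost, whose exponent per step is of order \<open>\<epsilon>\<close>.\<close>

section \<open>The path space of the walk\<close>

lemma less_exit_time_iff: "enat n < exit_time A s \<longleftrightarrow> (\<forall>k\<in>{1..n}. s k \<in> A)"
proof
  assume "enat n < exit_time A s"
  then have *: "enat n < enat k" if "1 \<le> k" "s k \<notin> A" for k
  proof -
    have "exit_time A s \<le> enat k"
      unfolding exit_time_def using that by (intro Inf_lower) auto
    then show ?thesis
      using \<open>enat n < exit_time A s\<close> by (rule less_le_trans[rotated])
  qed
  show "\<forall>k\<in>{1..n}. s k \<in> A"
    using * by force
next
  assume *: "\<forall>k\<in>{1..n}. s k \<in> A"
  have "enat (Suc n) \<le> exit_time A s"
    unfolding exit_time_def using * by (intro Inf_greatest) (force simp: not_less_eq_eq)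
  then show "enat n < exit_time A s"
    by (meson enat_ord_simps(2) lessI less_le_trans)
qed

definition position :: "nat \<Rightarrow> (nat \<Rightarrow> 'a::comm_monoid_add) \<Rightarrow> 'a" where
  "position n \<omega> = (\<Sum>i<n. \<omega> i)"

lemma position_0 [simp]: "position 0 \<omega> = 0"
  by (simp add: position_def)

lemma position_cong: "(\<And>i. i < n \<Longrightarrow> \<omega> i = \<omega>' i) \<Longrightarrow> position n \<omega> = position n \<omega>'"
  by (simp add: position_def)

lemma position_case_nat: "position (Suc n) (case_nat y \<omega>) = y + position n \<omega>"
  by (simp add: position_def sum.lessThan_Suc_shift del: sum.lessThan_Suc)

lemma position_add: "position (n + k) \<omega> = position n \<omega> + position k (\<lambda>i. \<omega> (i + n))"
  by (induction k) (simp_all add: position_def add_ac)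

locale random_increments = prob_space \<mu> for \<mu> :: "'a::euclidean_space measure" +
  assumes sets_eq_borel: "sets \<mu> = sets borel"
begin

lemmas [measurable_cong] = sets_eq_borel

abbreviation paths :: "(nat \<Rightarrow> 'a) measure" where
  "paths \<equiv> Pi\<^sub>M UNIV (\<lambda>_. \<mu>)"

lemma space_increments [simp]: "space \<mu> = UNIV"
  using sets_eq_imp_space_eq[OF sets_eq_borel] by simp

lemma space_paths [simp]: "space paths = UNIV"
  by (simp add: space_PiM)

sublocale seq: sequence_space \<mu> ..

lemma measurable_position [measurable]: "position n \<in> borel_measurable paths"
  unfolding position_def by measurable

text \<open>The Markov property at the deterministic time \<open>n\<close>: gluing the first \<open>n\<close> increments of one path to a
second, independent path yields a path with the same law.\<close>

lemma prob_concat: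
  assumes A: "A \<in> sets paths" and B: "B \<in> sets paths"
    and past: "\<And>\<omega> \<omega>'. (\<And>i. i < n \<Longrightarrow> \<omega> i = \<omega>' i) \<Longrightarrow> \<omega> \<in> A \<longleftrightarrow> \<omega>' \<in> A"
  shows "measure paths {\<omega>. \<omega> \<in> A \<and> (\<lambda>i. \<omega> (i + n)) \<in> B} = measure paths A * measure paths B"
proof -
  let ?C = "{\<omega>. \<omega> \<in> A \<and> (\<lambda>i. \<omega> (i + n)) \<in> B}"
  let ?f = "\<lambda>(\<omega>, \<omega>'). comb_seq n \<omega> \<omega>'"
  have shift: "(\<lambda>\<omega> i. \<omega> (i + n)) \<in> measurable paths paths"
    by (rule measurable_PiM_single') (auto simp: measurable_component_singleton)
  have C: "?C \<in> sets paths"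
  proof -
    have "?C = A \<inter> ((\<lambda>\<omega> i. \<omega> (i + n)) -` B \<inter> space paths)"
      by auto
    then show ?thesis
      using A measurable_sets[OF shift B] by auto
  qed
  have "comb_seq n \<omega> \<omega>' \<in> A \<longleftrightarrow> \<omega> \<in> A" for \<omega> \<omega>'
    by (rule past) (simp add: comb_seq_less)
  then have pre: "?f -` ?C \<inter> space (paths \<Otimes>\<^sub>M paths) = A \<times> B"
    by (auto simp: space_pair_measure comb_seq_add)
  have "emeasure paths ?C = emeasure (distr (paths \<Otimes>\<^sub>M paths) paths ?f) ?C"
    by (simp only: seq.PiM_comb_seq)
  also have "\<dots> = emeasure (paths \<Otimes>\<^sub>M paths) (A \<times> B)"
    unfolding pre[symmetric] by (rule emeasure_distr[OF measurable_comb_seq C])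
  also have "\<dots> = emeasure paths A * emeasure paths B"
    using A B by (rule seq.P.emeasure_pair_measure_Times)
  finally show ?thesis
    by (simp add: measure_def enn2real_mult)
qed

text \<open>Conditioning on the first increment; this drives the inductions on the number of steps.\<close>

lemma nn_integral_position_Suc:
  fixes f :: "'a \<Rightarrow> ennreal"
  assumes [measurable]: "f \<in> borel_measurable borel"
  shows "(\<integral>\<^sup>+\<omega>. f (position (Suc n) \<omega>) \<partial>paths)
    = (\<integral>\<^sup>+y. (\<integral>\<^sup>+\<omega>. f (y + position n \<omega>) \<partial>paths) \<partial>\<mu>)"
proof -
  have "(\<integral>\<^sup>+\<omega>. f (position (Suc n) \<omega>) \<partial>paths)
      = (\<integral>\<^sup>+\<omega>. f (position (Suc n) \<omega>) \<partial>distr (\<mu> \<Otimes>\<^sub>M paths) paths (\<lambda>(y, \<omega>). case_nat y \<omega>))"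
    by (simp only: seq.PiM_iter)
  also have "\<dots> = (\<integral>\<^sup>+z. f (position (Suc n) (case z of (y, \<omega>) \<Rightarrow> case_nat y \<omega>)) \<partial>(\<mu> \<Otimes>\<^sub>M paths))"
    by (rule nn_integral_distr) measurable
  also have "\<dots> = (\<integral>\<^sup>+z. f (fst z + position n (snd z)) \<partial>(\<mu> \<Otimes>\<^sub>M paths))"
    by (simp add: split_beta position_case_nat)
  also have "\<dots> = (\<integral>\<^sup>+y. (\<integral>\<^sup>+\<omega>. f (y + position n \<omega>) \<partial>paths) \<partial>\<mu>)"
    by (subst seq.P.nn_integral_fst[symmetric]) (simp_all, measurable)
  finally show ?thesis .
qed

lemma nn_integral_exp_position:
  "(\<integral>\<^sup>+\<omega>. ennreal (exp (x \<bullet> position n \<omega>)) \<partial>paths) = laplace_transform \<mu> x ^ n"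
proof (induction n)
  case 0
  show ?case using seq.P.emeasure_space_1 by simp
next
  case (Suc n)
  have "(\<integral>\<^sup>+\<omega>. ennreal (exp (x \<bullet> position (Suc n) \<omega>)) \<partial>paths)
     = (\<integral>\<^sup>+y. (\<integral>\<^sup>+\<omega>. ennreal (exp (x \<bullet> (y + position n \<omega>))) \<partial>paths) \<partial>\<mu>)"
    by (rule nn_integral_position_Suc) measurable
  also have "\<dots> = (\<integral>\<^sup>+y. ennreal (exp (x \<bullet> y)) * laplace_transform \<mu> x ^ n \<partial>\<mu>)"
    by (simp add: inner_add_right exp_add ennreal_mult' nn_integral_cmult Suc)
  also have "\<dots> = laplace_transform \<mu> x ^ Suc n"
    by (simp add: nn_integral_multc laplace_transform_def)
  finally show ?case .
qed

text \<open>Transfers the walk on an arbitrary probability space to the canonical space of increments: almost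
surely the path is its starting point plus the partial sums of its increments, whose joint law is
the product measure.\<close>

lemma random_walk_prob:
  assumes walk: "random_walk M S \<mu> x" and A[measurable]: "A \<in> sets (Pi\<^sub>M UNIV (\<lambda>_::nat. borel))"
  shows "measure M {\<omega> \<in> space M. (\<lambda>n. S n \<omega>) \<in> A} = measure paths {\<omega>. (\<lambda>n. x + position n \<omega>) \<in> A}"
proof -
  let ?N = "Pi\<^sub>M UNIV (\<lambda>_::nat. borel :: 'a measure)"
  define X where "X n \<omega> = S (Suc n) \<omega> - S n \<omega>" for n \<omega>
  interpret M: prob_space M using walk by (simp add: random_walk_def)
  have S[measurable]: "\<And>n. S n \<in> borel_measurable M" and start: "AE \<omega> in M. S 0 \<omega> = x"
    and indep: "M.indep_vars (\<lambda>_. borel) X UNIV" and law: "\<And>n. distr M borel (X n) = \<mu>"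
    using walk unfolding random_walk_def X_def by auto
  have X[measurable]: "\<And>n. X n \<in> borel_measurable M"
    unfolding X_def by measurable
  have XN: "(\<lambda>\<omega> n. X n \<omega>) \<in> measurable M ?N"
    by (rule measurable_PiM_single') auto
  have law_X: "distr M ?N (\<lambda>\<omega> n. X n \<omega>) = paths"
    using indep by (subst (asm) M.indep_vars_iff_distr_eq_PiM) (simp_all add: law restrict_UNIV)
  have pos[measurable]: "(\<lambda>\<omega> n. x + position n \<omega>) \<in> measurable ?N ?N"
    unfolding position_def by (rule measurable_PiM_single') auto
  have tele: "S n \<omega> = S 0 \<omega> + position n (\<lambda>n. X n \<omega>)" for n \<omega>
    by (induction n) (simp_all add: position_def X_def)
  have "measure M {\<omega> \<in> space M. (\<lambda>n. S n \<omega>) \<in> A}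
      = measure M {\<omega> \<in> space M. (\<lambda>n. x + position n (\<lambda>n. X n \<omega>)) \<in> A}"
  proof (rule M.finite_measure_eq_AE)
    show "AE \<omega> in M. \<omega> \<in> {\<omega> \<in> space M. (\<lambda>n. S n \<omega>) \<in> A} \<longleftrightarrow>
        \<omega> \<in> {\<omega> \<in> space M. (\<lambda>n. x + position n (\<lambda>n. X n \<omega>)) \<in> A}"
      using start
    proof eventually_elim
      case (elim \<omega>)
      then have "(\<lambda>n. S n \<omega>) = (\<lambda>n. x + position n (\<lambda>n. X n \<omega>))"
        by (intro ext) (subst tele, simp)
      then show ?case by simp
    qed
    have "(\<lambda>\<omega> n. S n \<omega>) \<in> measurable M ?N"
      by (rule measurable_PiM_single') auto
    from measurable_sets[OF this A] show "{\<omega> \<in> space M. (\<lambda>n. S n \<omega>) \<in> A} \<in> sets M"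
      by (simp add: vimage_def Int_def conj_commute)
    from measurable_sets[OF measurable_compose[OF XN pos] A]
    show "{\<omega> \<in> space M. (\<lambda>n. x + position n (\<lambda>n. X n \<omega>)) \<in> A} \<in> sets M"
      by (simp add: vimage_def Int_def conj_commute)
  qed
  also have "\<dots> = measure M ((\<lambda>\<omega> n. X n \<omega>) -` {\<omega>. (\<lambda>n. x + position n \<omega>) \<in> A} \<inter> space M)"
    by (rule arg_cong[where f = "measure M"]) auto
  also have "\<dots> = measure (distr M ?N (\<lambda>\<omega> n. X n \<omega>)) {\<omega>. (\<lambda>n. x + position n \<omega>) \<in> A}"
  proof (rule measure_distr[OF XN, symmetric])
    show "{\<omega>. (\<lambda>n. x + position n \<omega>) \<in> A} \<in> sets ?N"
      using measurable_sets[OF pos A] by (simp add: vimage_def space_PiM)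
  qed
  finally show ?thesis
    unfolding law_X .
qed

lemma random_walk_prob_stay:
  assumes walk: "random_walk M S \<mu> x" and C: "C \<in> sets borel" and D: "D \<in> sets borel"
  shows "measure M {\<omega> \<in> space M. enat n < exit_time C (\<lambda>k. S k \<omega>) \<and> S n \<omega> \<in> D}
    = measure paths {\<omega>. (\<forall>k\<in>{1..n}. x + position k \<omega> \<in> C) \<and> x + position n \<omega> \<in> D}"
proof -
  let ?A = "{s. (\<forall>k\<in>{1..n}. s k \<in> C) \<and> s n \<in> D}"
  have "{s \<in> space (Pi\<^sub>M UNIV (\<lambda>_::nat. borel)). (\<forall>k\<in>{1..n}. s k \<in> C) \<and> s n \<in> D}
      \<in> sets (Pi\<^sub>M UNIV (\<lambda>_::nat. borel))"
    using C D by measurable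
  then have "?A \<in> sets (Pi\<^sub>M UNIV (\<lambda>_::nat. borel))"
    by (simp add: space_PiM)
  from random_walk_prob[OF walk this] show ?thesis
    by (simp add: less_exit_time_iff)
qed

end

section \<open>Corridors parallel to the cone\<close>

text \<open>A multiple of a ball around \<open>v\<close> inside \<open>K\<close> is again inside \<open>K\<close>, so adding \<open>c v\<close> compensates every
deviation of size at most a fixed multiple of \<open>c\<close>.\<close>

lemma convex_cone_absorbs:
  fixes K :: "'a::real_normed_vector set"
  assumes K: "convex_cone K" and v: "v \<in> interior K"
  obtains e where "e > 0" "\<And>w c. norm w \<le> e * c \<Longrightarrow> w + c *\<^sub>R v \<in> K"
proof -
  obtain e where e: "e > 0" "cball v e \<subseteq> K"
    using v by (auto simp: mem_interior_cball)
  have "w + c *\<^sub>R v \<in> K" if "norm w \<le> e * c" for w c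
  proof (cases "c > 0")
    case True
    have "norm (w /\<^sub>R c) \<le> e"
      using that True by (simp add: field_simps)
    then have "v + w /\<^sub>R c \<in> K"
      using e(2) by (auto simp: dist_norm)
    then have "c *\<^sub>R (v + w /\<^sub>R c) \<in> K"
      using True by (intro convex_cone_scaleR[OF K]) auto
    then show ?thesis
      using True by (simp add: algebra_simps)
  next
    case False
    then have "e * c \<le> 0"
      using e(1) by (simp add: mult_nonneg_nonpos)
    with that norm_ge_zero[of w] have "norm w = 0" "e * c = 0"
      by linarith+
    with e(1) show ?thesis
      using convex_cone_contains_0[OF K] by simp
  qed
  with e(1) show thesis by (rule that)
qed

lemma interior_retreat:
  fixes K :: "'a::real_normed_vector set"
  assumes "w \<in> interior K"
  obtains \<rho> where "\<rho> > 0" "\<And>r. 0 \<le> r \<Longrightarrow> r \<le> \<rho> \<Longrightarrow> w - r *\<^sub>R v \<in> K"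
proof -
  obtain e where e: "e > 0" "cball w e \<subseteq> K"
    using assms by (auto simp: mem_interior_cball)
  have "w - r *\<^sub>R v \<in> K" if "0 \<le> r" "r \<le> e / (norm v + 1)" for r
  proof -
    have "r * norm v \<le> e / (norm v + 1) * (norm v + 1)"
      using that e(1) by (intro mult_mono) auto
    also have "\<dots> = e"
      using norm_ge_zero[of v] by (simp add: add_nonneg_eq_0_iff)
    finally show ?thesis
      using e(2) that(1) by (auto simp: dist_norm)
  qed
  moreover have "e / (norm v + 1) > 0"
    using e(1) by (intro divide_pos_pos) (auto intro: add_nonneg_pos)
  ultimately show thesis using that by blast
qed

text \<open>Paths that do not leave \<open>K - R v\<close> during the first \<open>n\<close> steps and end at depth \<open>\<rho>\<close> in the cone, that
is, in \<open>K + \<rho> v\<close>. The two parameters are independent: the depth gained in one stretch pays for the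
width of the corridor in the next one.\<close>

definition corridor :: "'a::real_vector set \<Rightarrow> 'a \<Rightarrow> nat \<Rightarrow> real \<Rightarrow> real \<Rightarrow> (nat \<Rightarrow> 'a) set" where
  "corridor K v n R \<rho> = {\<omega>. (\<forall>k\<in>{1..n}. position k \<omega> + R *\<^sub>R v \<in> K) \<and> position n \<omega> - \<rho> *\<^sub>R v \<in> K}"

lemma corridor_concat:
  assumes K: "convex_cone K" and v: "v \<in> K" and R': "R' \<le> R + \<rho>"
    and first: "\<omega> \<in> corridor K v n R \<rho>" and last: "(\<lambda>i. \<omega> (i + n)) \<in> corridor K v m R' \<rho>'"
  shows "\<omega> \<in> corridor K v (n + m) R (\<rho> + \<rho>')"
proof -
  let ?\<theta> = "\<lambda>i. \<omega> (i + n)"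
  have "position k \<omega> + R *\<^sub>R v \<in> K" if k: "1 \<le> k" "k \<le> n + m" for k
  proof (cases "k \<le> n")
    case True
    then show ?thesis using first k by (simp add: corridor_def)
  next
    case False
    then obtain j where j: "k = n + j" "1 \<le> j" "j \<le> m"
      using k that[of "k - n"] by linarith
    have "position n \<omega> - \<rho> *\<^sub>R v \<in> K" "position j ?\<theta> + R' *\<^sub>R v \<in> K" "(R + \<rho> - R') *\<^sub>R v \<in> K"
      using first last j R' convex_cone_scaleR[OF K _ v] by (auto simp: corridor_def)
    then have "(position n \<omega> - \<rho> *\<^sub>R v) + (position j ?\<theta> + R' *\<^sub>R v) + (R + \<rho> - R') *\<^sub>R v \<in> K"
      by (rule convex_cone_add[OF K convex_cone_add[OF K]])
    then show ?thesis
      unfolding j(1) position_add by (simp add: algebra_simps)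
  qed
  moreover have "position (n + m) \<omega> - (\<rho> + \<rho>') *\<^sub>R v \<in> K"
  proof -
    have "(position n \<omega> - \<rho> *\<^sub>R v) + (position m ?\<theta> - \<rho>' *\<^sub>R v) \<in> K"
      by (rule convex_cone_add[OF K]) (use first last in \<open>auto simp: corridor_def\<close>)
    then show ?thesis
      unfolding position_add by (simp add: algebra_simps)
  qed
  ultimately show ?thesis
    by (simp add: corridor_def)
qed

context random_increments
begin

lemma corridor_in_sets:
  assumes "closed K"
  shows "corridor K v n R \<rho> \<in> sets paths"
proof -
  have [measurable]: "K \<in> sets borel"
    using assms by (rule borel_closed)
  have "{\<omega> \<in> space paths. (\<forall>k\<in>{1..n}. position k \<omega> + R *\<^sub>R v \<in> K) \<and> position n \<omega> - \<rho> *\<^sub>R v \<in> K} \<in> sets paths"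
    by measurable
  then show ?thesis by (simp add: corridor_def)
qed

context
  fixes K :: "'a set" and v :: 'a
  assumes K: "convex_cone K" and closed: "closed K" and v: "v \<in> interior K"
begin

lemma v_mem: "v \<in> K"
  using v interior_subset by blast

lemma prob_corridor_concat:
  assumes "R' \<le> R + \<rho>"
  shows "measure paths (corridor K v n R \<rho>) * measure paths (corridor K v m R' \<rho>')
    \<le> measure paths (corridor K v (n + m) R (\<rho> + \<rho>'))"
proof -
  have "measure paths (corridor K v n R \<rho>) * measure paths (corridor K v m R' \<rho>')
     = measure paths {\<omega>. \<omega> \<in> corridor K v n R \<rho> \<and> (\<lambda>i. \<omega> (i + n)) \<in> corridor K v m R' \<rho>'}"
  proof (rule prob_concat[symmetric, OF corridor_in_sets[OF closed] corridor_in_sets[OF closed]])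
    fix \<omega> \<omega>' :: "nat \<Rightarrow> 'a"
    assume "\<And>i. i < n \<Longrightarrow> \<omega> i = \<omega>' i"
    then have "\<And>k. k \<le> n \<Longrightarrow> position k \<omega> = position k \<omega>'"
      by (intro position_cong) auto
    then show "\<omega> \<in> corridor K v n R \<rho> \<longleftrightarrow> \<omega>' \<in> corridor K v n R \<rho>"
      by (simp add: corridor_def)
  qed
  also have "\<dots> \<le> measure paths (corridor K v (n + m) R (\<rho> + \<rho>'))"
    using corridor_concat[OF K v_mem assms]
    by (intro seq.P.finite_measure_mono corridor_in_sets[OF closed]) auto
  finally show ?thesis .
qed

lemma prob_corridor_power:
  assumes "0 \<le> \<rho>"
  shows "measure paths (corridor K v n R \<rho>) ^ k \<le> measure paths (corridor K v (k * n) R (real k * \<rho>))"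
proof (induction k)
  case 0
  have "corridor K v 0 R 0 = space paths"
    using convex_cone_contains_0[OF K] by (simp add: corridor_def)
  then show ?case
    using seq.P.prob_space by (simp del: space_paths)
next
  case (Suc k)
  have "measure paths (corridor K v n R \<rho>) ^ Suc k
      \<le> measure paths (corridor K v (k * n) R (real k * \<rho>)) * measure paths (corridor K v n R \<rho>)"
    using mult_right_mono[OF Suc measure_nonneg] by (simp add: mult.commute)
  also have "\<dots> \<le> measure paths (corridor K v (k * n + n) R (real k * \<rho> + \<rho>))"
    using assms by (intro prob_corridor_concat) auto
  finally show ?case
    by (simp add: algebra_simps)
qed

text \<open>Finitely many positions always fit in a sufficiently wide corridor.\<close>

lemma prob_corridor_wide_tendsto:
  "(\<lambda>R. measure paths (corridor K v n (real R) 0)) \<longlonglongrightarrow> measure paths {\<omega>. position n \<omega> \<in> K}"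
proof -
  obtain e where e: "e > 0" "\<And>w c. norm w \<le> e * c \<Longrightarrow> w + c *\<^sub>R v \<in> K"
    using convex_cone_absorbs[OF K v] by blast
  have "incseq (\<lambda>R. corridor K v n (real R) 0)"
  proof (rule incseq_SucI, rule subsetI)
    fix R \<omega> assume "\<omega> \<in> corridor K v n (real R) 0"
    have "(position k \<omega> + real R *\<^sub>R v) + v \<in> K" if "k \<in> {1..n}" for k
      by (rule convex_cone_add[OF K _ v_mem]) (use that \<open>\<omega> \<in> corridor K v n (real R) 0\<close> in \<open>simp add: corridor_def\<close>)
    then show "\<omega> \<in> corridor K v n (real (Suc R)) 0"
      using \<open>\<omega> \<in> corridor K v n (real R) 0\<close> by (simp add: corridor_def algebra_simps)
  qed
  moreover have "(\<Union>R. corridor K v n (real R) 0) = {\<omega>. position n \<omega> \<in> K}"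
  proof (intro equalityI subsetI)
    fix \<omega> assume *: "\<omega> \<in> {\<omega>. position n \<omega> \<in> K}"
    define M where "M = Max ((\<lambda>k. norm (position k \<omega>)) ` {..n})"
    obtain R where R: "M / e \<le> real R"
      using real_arch_simple by blast
    have "norm (position k \<omega>) \<le> e * real R" if "k \<le> n" for k
    proof -
      have "norm (position k \<omega>) \<le> M"
        unfolding M_def using that by (intro Max_ge) auto
      also have "\<dots> \<le> e * real R"
        using R e(1) by (simp add: field_simps)
      finally show ?thesis .
    qed
    then have "\<omega> \<in> corridor K v n (real R) 0"
      using * e(2) by (auto simp: corridor_def)
    then show "\<omega> \<in> (\<Union>R. corridor K v n (real R) 0)" by blast
  qed (auto simp: corridor_def)
  ultimately show ?thesis
    using seq.P.finite_Lim_measure_incseq[of "\<lambda>R. corridor K v n (real R) 0"]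
    by (simp add: image_subset_iff corridor_in_sets[OF closed])
qed

text \<open>A single time \<open>N\<close> controls the exponential rate. The hypothesis \<open>start\<close> lets the walk gain some depth
with positive probability without leaving \<open>K - \<delta> v\<close>; repeating this a fixed number of times gains
depth \<open>R\<close>, at the price of the constant \<open>c\<close>. From depth \<open>R\<close> one can afford successive stretches of
length \<open>N\<close> through the corridor of width \<open>R\<close>, each of which ends in \<open>K\<close> relative to its starting
point and so restores the depth. For large \<open>R\<close> such a stretch costs hardly more than the event
that the position at time \<open>N\<close> lies in \<open>K\<close>.\<close>

lemma prob_stay_lower_bound:
  assumes \<delta>: "0 \<le> \<delta>" and start: "measure paths {\<omega>. (\<forall>k\<in>{1..n0}. position k \<omega> + \<delta> *\<^sub>R v \<in> K) \<and> position n0 \<omega> \<in> interior K} > 0"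
    and N: "N \<ge> 1" and q: "0 < q" "q < measure paths {\<omega>. position N \<omega> \<in> K}"
  shows "\<exists>c>0. \<forall>n. c * q ^ (n div N) \<le> measure paths {\<omega>. \<forall>k\<in>{1..n}. position k \<omega> + \<delta> *\<^sub>R v \<in> K}"
proof -
  \<comment> \<open>The interior of the cone is exhausted by countably many shifts \<open>K + \<rho> v\<close>.\<close>
  have "\<exists>\<rho>>0. measure paths (corridor K v n0 \<delta> \<rho>) > 0"
  proof (rule ccontr)
    assume *: "\<not> ?thesis"
    have "corridor K v n0 \<delta> (1 / real (Suc j)) \<in> null_sets paths" for j
    proof -
      have "\<not> measure paths (corridor K v n0 \<delta> (1 / real (Suc j))) > 0"
        using * by (metis of_nat_0_less_iff zero_less_Suc zero_less_divide_1_iff)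
      then have "measure paths (corridor K v n0 \<delta> (1 / real (Suc j))) = 0"
        using measure_nonneg by (rule antisym[OF leI])
      then show ?thesis
        using corridor_in_sets[OF closed] by (auto simp: null_sets_def seq.P.emeasure_eq_measure)
    qed
    then have null: "(\<Union>j. corridor K v n0 \<delta> (1 / real (Suc j))) \<in> null_sets paths"
      by (rule null_sets_UN)
    have "{\<omega>. (\<forall>k\<in>{1..n0}. position k \<omega> + \<delta> *\<^sub>R v \<in> K) \<and> position n0 \<omega> \<in> interior K}
       \<subseteq> (\<Union>j. corridor K v n0 \<delta> (1 / real (Suc j)))"
    proof safe
      fix \<omega> assume w: "\<forall>k\<in>{1..n0}. position k \<omega> + \<delta> *\<^sub>R v \<in> K" "position n0 \<omega> \<in> interior K"
      obtain \<rho> where \<rho>: "\<rho> > 0" "\<And>r. 0 \<le> r \<Longrightarrow> r \<le> \<rho> \<Longrightarrow> position n0 \<omega> - r *\<^sub>R v \<in> K"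
        using interior_retreat[OF w(2)] by blast
      obtain j where "1 / real (Suc j) < \<rho>"
        using \<rho>(1) nat_approx_posE by blast
      then show "\<omega> \<in> (\<Union>j. corridor K v n0 \<delta> (1 / real (Suc j)))"
        using w(1) \<rho>(2)[of "1 / real (Suc j)"] by (auto simp: corridor_def intro!: exI[of _ j])
    qed
    then have "measure paths {\<omega>. (\<forall>k\<in>{1..n0}. position k \<omega> + \<delta> *\<^sub>R v \<in> K) \<and> position n0 \<omega> \<in> interior K}
        \<le> measure paths (\<Union>j. corridor K v n0 \<delta> (1 / real (Suc j)))"
      using null by (intro seq.P.finite_measure_mono) auto
    also have "\<dots> = 0"
      using null by (rule measure_eq_0_null_sets)
    finally have "measure paths {\<omega>. (\<forall>k\<in>{1..n0}. position k \<omega> + \<delta> *\<^sub>R v \<in> K) \<and> position n0 \<omega> \<in> interior K} \<le> 0" .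
    with start show False by simp
  qed
  then obtain \<rho> where \<rho>: "\<rho> > 0" "measure paths (corridor K v n0 \<delta> \<rho>) > 0" by blast
  obtain R where R: "q < measure paths (corridor K v N (real R) 0)"
    using order_tendstoD(1)[OF prob_corridor_wide_tendsto q(2)] by (meson eventually_happens' sequentially_bot)
  obtain k where k: "real R / \<rho> \<le> real k"
    using real_arch_simple by blast
  then have k: "real R \<le> \<delta> + real k * \<rho>"
    using \<rho>(1) \<delta> by (simp add: field_simps)
  define c where "c = measure paths (corridor K v (k * n0) \<delta> (real k * \<rho>))"
  have c: "c > 0"
    unfolding c_def using prob_corridor_power[of \<rho> n0 \<delta> k] \<rho> zero_less_power[OF \<rho>(2), of k] by linarith
  have "c * q * q ^ (n div N) \<le> measure paths {\<omega>. \<forall>k\<in>{1..n}. position k \<omega> + \<delta> *\<^sub>R v \<in> K}" for n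
  proof -
    \<comment> \<open>One stretch more than fits completely into time \<open>n\<close>; it is absorbed in the factor \<open>q\<close>.\<close>
    define j where "j = Suc (n div N)"
    have "n \<le> j * N"
      using N dividend_less_div_times[of N n] by (simp add: j_def)
    have "c * q * q ^ (n div N) = c * q ^ j"
      by (simp add: j_def)
    also have "\<dots> \<le> c * measure paths (corridor K v N (real R) 0) ^ j"
      using c R q by (intro mult_left_mono power_mono) auto
    also have "\<dots> \<le> c * measure paths (corridor K v (j * N) (real R) 0)"
      using c prob_corridor_power[of 0 N "real R" j] by (intro mult_left_mono) auto
    also have "\<dots> \<le> measure paths (corridor K v (k * n0 + j * N) \<delta> (real k * \<rho> + 0))"
      unfolding c_def by (rule prob_corridor_concat[OF k])
    also have "\<dots> \<le> measure paths {\<omega>. \<forall>k\<in>{1..n}. position k \<omega> + \<delta> *\<^sub>R v \<in> K}"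
    proof (rule seq.P.finite_measure_mono)
      show "corridor K v (k * n0 + j * N) \<delta> (real k * \<rho> + 0)
          \<subseteq> {\<omega>. \<forall>k\<in>{1..n}. position k \<omega> + \<delta> *\<^sub>R v \<in> K}"
        using \<open>n \<le> j * N\<close> by (auto simp: corridor_def)
      have [measurable]: "K \<in> sets borel"
        using closed by (rule borel_closed)
      have "{\<omega> \<in> space paths. \<forall>k\<in>{1..n}. position k \<omega> + \<delta> *\<^sub>R v \<in> K} \<in> sets paths"
        by measurable
      then show "{\<omega>. \<forall>k\<in>{1..n}. position k \<omega> + \<delta> *\<^sub>R v \<in> K} \<in> sets paths"
        by simp
    qed
    finally show ?thesis .
  qed
  moreover have "c * q > 0"
    using c q by simp
  ultimately show ?thesis by blast
qed

end

end

section \<open>Exponential moments of the increments\<close>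

text \<open>The remainder is stated with \<open>exp \<bar>u\<bar>\<close> so that it holds for both signs and can be absorbed in
an integrable exponential of the norm.\<close>

lemma exp_minus_linear_le: "exp (u::real) \<le> 1 + u + u\<^sup>2 * exp \<bar>u\<bar>"
proof -
  have 1: "exp u - 1 \<le> u * exp u"
  proof -
    have "exp u * (1 - u) \<le> exp u * exp (- u)"
      using exp_ge_add_one_self[of "- u"] by (intro mult_left_mono) auto
    then show ?thesis by (simp add: exp_minus algebra_simps)
  qed
  show ?thesis
  proof (cases "u \<ge> 0")
    case True
    have "u * (exp u - 1) \<le> u * (u * exp u)"
      using 1 True by (rule mult_left_mono)
    with 1 True show ?thesis
      by (simp add: algebra_simps power2_eq_square)
  next
    case False
    have "u * (exp u - 1) \<le> u * u"
      using exp_ge_add_one_self[of u] False by (intro mult_left_mono_neg) (linarith, simp)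
    moreover have "u * u * 1 \<le> u * u * exp \<bar>u\<bar>"
      by (intro mult_left_mono) auto
    ultimately show ?thesis
      using 1 by (simp add: algebra_simps power2_eq_square)
  qed
qed

lemma square_le_exp:
  fixes s u :: real
  assumes "s > 0" "u \<ge> 0"
  shows "u\<^sup>2 \<le> 2 / s\<^sup>2 * exp (s * u)"
proof -
  have "(s * u)\<^sup>2 / 2 \<le> exp (s * u)"
    using exp_lower_Taylor_quadratic[of "s * u"] mult_nonneg_nonneg[of s u] assms by linarith
  then show ?thesis
    using assms by (simp add: field_simps power_mult_distrib)
qed

text \<open>The largest coordinate of \<open>y\<close> is at least its norm divided by the dimension; hence finiteness of the
Laplace transform near a point, in the coordinate directions alone, controls exponentials of the norm.\<close>

lemma exp_norm_le_sum_exp_inner: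
  fixes y :: "'a::euclidean_space"
  assumes "s \<ge> 0"
  shows "exp (s * norm y) \<le> (\<Sum>b\<in>Basis. exp (((s * DIM('a)) *\<^sub>R b) \<bullet> y) + exp (- (((s * DIM('a)) *\<^sub>R b) \<bullet> y)))"
proof -
  define M where "M = Max ((\<lambda>b. \<bar>y \<bullet> b\<bar>) ` (Basis :: 'a set))"
  have "M \<in> (\<lambda>b. \<bar>y \<bullet> b\<bar>) ` (Basis :: 'a set)"
    unfolding M_def by (intro Max_in) auto
  then obtain b :: 'a where b: "b \<in> Basis" "M = \<bar>y \<bullet> b\<bar>" by blast
  have "norm y \<le> (\<Sum>i\<in>Basis. \<bar>y \<bullet> i\<bar>)"
    by (rule norm_le_l1)
  also have "\<dots> \<le> (\<Sum>i\<in>(Basis::'a set). M)"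
    unfolding M_def by (intro sum_mono Max_ge) auto
  finally have "norm y \<le> DIM('a) * \<bar>y \<bullet> b\<bar>"
    by (simp add: b(2))
  then have "s * norm y \<le> s * (DIM('a) * \<bar>y \<bullet> b\<bar>)"
    using assms by (rule mult_left_mono)
  also have "\<dots> = \<bar>((s * DIM('a)) *\<^sub>R b) \<bullet> y\<bar>"
    using assms by (simp add: abs_mult inner_commute)
  finally have "exp (s * norm y) \<le> exp \<bar>((s * DIM('a)) *\<^sub>R b) \<bullet> y\<bar>"
    by simp
  also have "\<dots> \<le> exp (((s * DIM('a)) *\<^sub>R b) \<bullet> y) + exp (- (((s * DIM('a)) *\<^sub>R b) \<bullet> y))"
    by (simp add: abs_if)
  also have "\<dots> \<le> (\<Sum>b\<in>Basis. exp (((s * DIM('a)) *\<^sub>R b) \<bullet> y) + exp (- (((s * DIM('a)) *\<^sub>R b) \<bullet> y)))"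
    by (rule member_le_sum[OF b(1), where f = "\<lambda>b. exp (((s * DIM('a)) *\<^sub>R b) \<bullet> y) + exp (- (((s * DIM('a)) *\<^sub>R b) \<bullet> y))"])
      auto
  finally show ?thesis .
qed

context random_increments
begin

definition mgf :: "'a \<Rightarrow> real" where
  "mgf x = (LINT y|\<mu>. exp (x \<bullet> y))"

definition mgf_gradient :: "'a \<Rightarrow> 'a" where
  "mgf_gradient x = (LINT y|\<mu>. exp (x \<bullet> y) *\<^sub>R y)"

lemma integrable_exp_inner_iff:
  "integrable \<mu> (\<lambda>y. exp (x \<bullet> y)) \<longleftrightarrow> laplace_transform \<mu> x < \<infinity>"
  unfolding laplace_transform_def by (simp add: integrable_iff_bounded)

lemma laplace_transform_eq_mgf:
  "integrable \<mu> (\<lambda>y. exp (x \<bullet> y)) \<Longrightarrow> laplace_transform \<mu> x = ennreal (mgf x)"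
  unfolding laplace_transform_def mgf_def by (simp add: nn_integral_eq_integral)

lemma mgf_pos:
  assumes "integrable \<mu> (\<lambda>y. exp (x \<bullet> y))"
  shows "mgf x > 0"
proof -
  have "mgf x \<noteq> 0"
  proof
    assume "mgf x = 0"
    then have "AE y in \<mu>. exp (x \<bullet> y) = 0"
      unfolding mgf_def using assms by (subst (asm) integral_nonneg_eq_0_iff_AE) auto
    then show False by (simp add: AE_False)
  qed
  moreover have "mgf x \<ge> 0"
    unfolding mgf_def by simp
  ultimately show ?thesis by simp
qed

lemma integrable_exp_inner_norm:
  assumes "r > 0" and fin: "\<And>z. z \<in> ball x r \<Longrightarrow> laplace_transform \<mu> z < \<infinity>"
  obtains s where "s > 0" "integrable \<mu> (\<lambda>y. exp (x \<bullet> y) * exp (s * norm y))"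
proof -
  define t where "t = r / 2"
  define s where "s = t / DIM('a)"
  have s: "s > 0" "s * DIM('a) = t" and t: "0 < t" "t < r"
    using assms(1) by (auto simp: s_def t_def)
  have int: "integrable \<mu> (\<lambda>y. exp ((x + t *\<^sub>R b) \<bullet> y))" "integrable \<mu> (\<lambda>y. exp ((x - t *\<^sub>R b) \<bullet> y))"
    if "b \<in> Basis" for b
    using fin[of "x + t *\<^sub>R b"] fin[of "x - t *\<^sub>R b"] that t
    by (auto simp: integrable_exp_inner_iff dist_norm)
  have "integrable \<mu> (\<lambda>y. exp (x \<bullet> y) * exp (s * norm y))"
  proof (rule Bochner_Integration.integrable_bound)
    show "integrable \<mu> (\<lambda>y. \<Sum>b\<in>Basis. exp ((x + t *\<^sub>R b) \<bullet> y) + exp ((x - t *\<^sub>R b) \<bullet> y))"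
      using int by auto
    show "AE y in \<mu>. norm (exp (x \<bullet> y) * exp (s * norm y))
        \<le> norm (\<Sum>b\<in>Basis. exp ((x + t *\<^sub>R b) \<bullet> y) + exp ((x - t *\<^sub>R b) \<bullet> y))"
    proof (rule AE_I2)
      fix y
      have "exp (x \<bullet> y) * exp (s * norm y)
          \<le> exp (x \<bullet> y) * (\<Sum>b\<in>Basis. exp ((t *\<^sub>R b) \<bullet> y) + exp (- ((t *\<^sub>R b) \<bullet> y)))"
        using exp_norm_le_sum_exp_inner[of s y] s by (intro mult_left_mono) auto
      also have "\<dots> = (\<Sum>b\<in>Basis. exp ((x + t *\<^sub>R b) \<bullet> y) + exp ((x - t *\<^sub>R b) \<bullet> y))"
        by (simp add: sum_distrib_left inner_add_left inner_diff_left exp_add exp_diff exp_minus field_simps)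
      finally show "norm (exp (x \<bullet> y) * exp (s * norm y))
        \<le> norm (\<Sum>b\<in>Basis. exp ((x + t *\<^sub>R b) \<bullet> y) + exp ((x - t *\<^sub>R b) \<bullet> y))"
        by simp
    qed
  qed measurable
  with s show thesis by (intro that)
qed

lemma integrable_exp_inner_square:
  assumes s: "s > 0" "integrable \<mu> (\<lambda>y. exp (x \<bullet> y) * exp (s * norm y))"
  shows "integrable \<mu> (\<lambda>y. exp (x \<bullet> y) * (norm y)\<^sup>2)"
proof (rule Bochner_Integration.integrable_bound)
  show "integrable \<mu> (\<lambda>y. (2 / s\<^sup>2) * (exp (x \<bullet> y) * exp (s * norm y)))"
    using s(2) by (rule integrable_mult_right)
  show "AE y in \<mu>. norm (exp (x \<bullet> y) * (norm y)\<^sup>2) \<le> norm ((2 / s\<^sup>2) * (exp (x \<bullet> y) * exp (s * norm y)))"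
  proof (rule AE_I2)
    fix y
    have "exp (x \<bullet> y) * (norm y)\<^sup>2 \<le> exp (x \<bullet> y) * (2 / s\<^sup>2 * exp (s * norm y))"
      using s(1) by (intro mult_left_mono square_le_exp) auto
    then show "norm (exp (x \<bullet> y) * (norm y)\<^sup>2) \<le> norm ((2 / s\<^sup>2) * (exp (x \<bullet> y) * exp (s * norm y)))"
      by (simp add: mult_ac)
  qed
qed measurable

lemma integrable_exp_inner_scaleR:
  assumes "integrable \<mu> (\<lambda>y. exp (x \<bullet> y))" "integrable \<mu> (\<lambda>y. exp (x \<bullet> y) * (norm y)\<^sup>2)"
  shows "integrable \<mu> (\<lambda>y. exp (x \<bullet> y) *\<^sub>R y)"
proof (rule Bochner_Integration.integrable_bound)
  show "integrable \<mu> (\<lambda>y. exp (x \<bullet> y) + exp (x \<bullet> y) * (norm y)\<^sup>2)"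
    using assms by simp
  show "AE y in \<mu>. norm (exp (x \<bullet> y) *\<^sub>R y) \<le> norm (exp (x \<bullet> y) + exp (x \<bullet> y) * (norm y)\<^sup>2)"
  proof (rule AE_I2)
    fix y :: 'a
    have "0 \<le> (norm y - 1)\<^sup>2"
      by simp
    then have "2 * norm y \<le> 1 + (norm y)\<^sup>2"
      by (simp add: power2_diff)
    with norm_ge_zero[of y] have "norm y \<le> 1 + (norm y)\<^sup>2"
      by linarith
    then have "exp (x \<bullet> y) * norm y \<le> exp (x \<bullet> y) * (1 + (norm y)\<^sup>2)"
      by (intro mult_left_mono) auto
    then show "norm (exp (x \<bullet> y) *\<^sub>R y) \<le> norm (exp (x \<bullet> y) + exp (x \<bullet> y) * (norm y)\<^sup>2)"
      by (simp add: distrib_left)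
  qed
qed measurable

lemma
  assumes "integrable \<mu> (\<lambda>y. exp (x \<bullet> y))" "integrable \<mu> (\<lambda>y. exp (x \<bullet> y) * (norm y)\<^sup>2)"
  shows integrable_exp_inner_mult_inner: "integrable \<mu> (\<lambda>y. exp (x \<bullet> y) * (z \<bullet> y))"
    and inner_mgf_gradient: "(LINT y|\<mu>. exp (x \<bullet> y) * (z \<bullet> y)) = z \<bullet> mgf_gradient x"
  using integrable_inner_right[OF integrable_exp_inner_scaleR[OF assms], of z]
    integral_inner_right[OF integrable_exp_inner_scaleR[OF assms], of z]
  unfolding mgf_gradient_def by simp_all

text \<open>A one-sided second order expansion. It replaces differentiation under the integral sign: at a
minimum only an upper bound for the perturbed value is needed.\<close>

lemma mgf_second_order_bound:
  assumes s: "s > 0" "integrable \<mu> (\<lambda>y. exp (x \<bullet> y) * exp (s * norm y))"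
    and int: "integrable \<mu> (\<lambda>y. exp (x \<bullet> y))"
    and z: "norm z \<le> s / 2"
  shows "mgf (x + z) \<le> mgf x + z \<bullet> mgf_gradient x
    + (norm z)\<^sup>2 * (8 / s\<^sup>2 * (LINT y|\<mu>. exp (x \<bullet> y) * exp (s * norm y)))"
proof -
  note sq = integrable_exp_inner_square[OF s]
  note lin = integrable_exp_inner_mult_inner[OF int sq]
  define c where "c = (norm z)\<^sup>2 * (8 / s\<^sup>2)"
  let ?g = "\<lambda>y. exp (x \<bullet> y) + exp (x \<bullet> y) * (z \<bullet> y) + c * (exp (x \<bullet> y) * exp (s * norm y))"
  have pointwise: "exp ((x + z) \<bullet> y) \<le> ?g y" for y
  proof -
    have zy: "\<bar>z \<bullet> y\<bar> \<le> norm z * norm y"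
      by (rule Cauchy_Schwarz_ineq2)
    also have "\<dots> \<le> s / 2 * norm y"
      using z by (intro mult_right_mono) auto
    finally have zy': "\<bar>z \<bullet> y\<bar> \<le> s / 2 * norm y" .
    have "(z \<bullet> y)\<^sup>2 \<le> (norm z * norm y)\<^sup>2"
      using zy by (metis abs_ge_zero power2_abs power_mono)
    also have "\<dots> \<le> (norm z)\<^sup>2 * (2 / (s / 2)\<^sup>2 * exp (s / 2 * norm y))"
      unfolding power_mult_distrib using s(1) by (intro mult_left_mono square_le_exp) auto
    finally have "(z \<bullet> y)\<^sup>2 \<le> c * exp (s / 2 * norm y)"
      by (simp add: c_def power2_eq_square)
    then have "(z \<bullet> y)\<^sup>2 * exp \<bar>z \<bullet> y\<bar> \<le> c * exp (s / 2 * norm y) * exp (s / 2 * norm y)"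
      using zy' by (intro mult_mono) (auto simp: c_def)
    also have "\<dots> = c * exp (s * norm y)"
      by (simp add: mult_exp_exp mult.assoc)
    finally have "exp (z \<bullet> y) \<le> 1 + z \<bullet> y + c * exp (s * norm y)"
      using exp_minus_linear_le[of "z \<bullet> y"] by linarith
    then have "exp (x \<bullet> y) * exp (z \<bullet> y) \<le> exp (x \<bullet> y) * (1 + z \<bullet> y + c * exp (s * norm y))"
      by (intro mult_left_mono) auto
    then show ?thesis
      by (simp add: inner_add_left exp_add algebra_simps)
  qed
  have intg: "integrable \<mu> ?g"
    using int lin s(2) by auto
  have "mgf (x + z) \<le> (LINT y|\<mu>. ?g y)"
    unfolding mgf_def
  proof (rule integral_mono)
    show "integrable \<mu> (\<lambda>y. exp ((x + z) \<bullet> y))"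
      by (rule Bochner_Integration.integrable_bound[OF intg])
        (use pointwise in \<open>auto intro: order_trans[OF _ abs_ge_self]\<close>)
  qed (use intg pointwise in auto)
  also have "\<dots> = mgf x + z \<bullet> mgf_gradient x + c * (LINT y|\<mu>. exp (x \<bullet> y) * exp (s * norm y))"
    using int lin s(2) by (simp add: mgf_def inner_mgf_gradient[OF int sq])
  finally show ?thesis
    by (simp add: c_def)
qed

section \<open>The weak law of large numbers after exponential tilting\<close>

text \<open>Under the law with density \<open>exp (x \<bullet> y) / mgf x\<close> the increments have mean \<open>m\<close> and variance \<open>\<sigma>\<close>, so
the squared distance of the walk from \<open>n m\<close> grows linearly. The weights are kept as an integrand, so
that no second path measure is needed; the extra starting point \<open>a\<close> carries the induction, in which
the mixed term vanishes because \<open>m\<close> is the tilted mean.\<close>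

lemma tilted_second_moment:
  fixes x :: 'a
  assumes int: "integrable \<mu> (\<lambda>y. exp (x \<bullet> y))" and sq: "integrable \<mu> (\<lambda>y. exp (x \<bullet> y) * (norm y)\<^sup>2)"
  defines "m \<equiv> mgf_gradient x /\<^sub>R mgf x"
  defines "\<sigma> \<equiv> (LINT y|\<mu>. exp (x \<bullet> y) * (norm (y - m))\<^sup>2) / mgf x"
  shows "(\<integral>\<^sup>+\<omega>. ennreal (exp (x \<bullet> position n \<omega>) * (norm (a + position n \<omega> - real n *\<^sub>R m))\<^sup>2) \<partial>paths)
    = ennreal (mgf x ^ n * ((norm a)\<^sup>2 + real n * \<sigma>))"
proof (induction n arbitrary: a)
  case 0
  show ?case using seq.P.emeasure_space_1 by simp
next
  case (Suc n)
  note L = mgf_pos[OF int]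
  note lin = integrable_exp_inner_mult_inner[OF int sq]
  have \<sigma>: "\<sigma> \<ge> 0"
    unfolding \<sigma>_def using L by simp
  have sq_m: "integrable \<mu> (\<lambda>y. exp (x \<bullet> y) * (norm (y - m))\<^sup>2)"
  proof -
    have "integrable \<mu> (\<lambda>y. exp (x \<bullet> y) * (norm y)\<^sup>2 - 2 * (exp (x \<bullet> y) * (m \<bullet> y)) + exp (x \<bullet> y) * (norm m)\<^sup>2)"
      using int sq lin by auto
    then show ?thesis
      by (rule Bochner_Integration.integrable_cong[THEN iffD1, rotated 2])
        (auto simp: dot_square_norm[symmetric] inner_diff_left inner_diff_right inner_commute algebra_simps)
  qed
  have "(\<integral>\<^sup>+\<omega>. ennreal (exp (x \<bullet> position (Suc n) \<omega>) * (norm (a + position (Suc n) \<omega> - real (Suc n) *\<^sub>R m))\<^sup>2) \<partial>paths)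
    = (\<integral>\<^sup>+y. (\<integral>\<^sup>+\<omega>. ennreal (exp (x \<bullet> (y + position n \<omega>)) * (norm (a + (y + position n \<omega>) - real (Suc n) *\<^sub>R m))\<^sup>2) \<partial>paths) \<partial>\<mu>)"
    by (rule nn_integral_position_Suc) measurable
  also have "\<dots> = (\<integral>\<^sup>+y. ennreal (exp (x \<bullet> y)) *
      (\<integral>\<^sup>+\<omega>. ennreal (exp (x \<bullet> position n \<omega>) * (norm ((a + (y - m)) + position n \<omega> - real n *\<^sub>R m))\<^sup>2) \<partial>paths) \<partial>\<mu>)"
    by (subst nn_integral_cmult[symmetric])
      (simp_all add: ennreal_mult'[symmetric] inner_add_right exp_add algebra_simps)
  also have "\<dots> = (\<integral>\<^sup>+y. ennreal (exp (x \<bullet> y) * (mgf x ^ n * ((norm (a + (y - m)))\<^sup>2 + real n * \<sigma>))) \<partial>\<mu>)"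
    unfolding Suc using L by (simp add: ennreal_mult'[symmetric])
  also have "\<dots> = (\<integral>\<^sup>+y. ennreal (mgf x ^ n * (exp (x \<bullet> y) * ((norm a)\<^sup>2 + real n * \<sigma>)
      + 2 * (exp (x \<bullet> y) * (a \<bullet> y) - exp (x \<bullet> y) * (a \<bullet> m)) + exp (x \<bullet> y) * (norm (y - m))\<^sup>2)) \<partial>\<mu>)"
    by (intro nn_integral_cong arg_cong[where f = ennreal])
      (simp add: dot_square_norm[symmetric] inner_add_left inner_add_right inner_diff_left inner_diff_right inner_commute algebra_simps)
  also have "\<dots> = ennreal (LINT y|\<mu>. mgf x ^ n * (exp (x \<bullet> y) * ((norm a)\<^sup>2 + real n * \<sigma>)
      + 2 * (exp (x \<bullet> y) * (a \<bullet> y) - exp (x \<bullet> y) * (a \<bullet> m)) + exp (x \<bullet> y) * (norm (y - m))\<^sup>2))"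
  proof (rule nn_integral_eq_integral)
    show "integrable \<mu> (\<lambda>y. mgf x ^ n * (exp (x \<bullet> y) * ((norm a)\<^sup>2 + real n * \<sigma>)
      + 2 * (exp (x \<bullet> y) * (a \<bullet> y) - exp (x \<bullet> y) * (a \<bullet> m)) + exp (x \<bullet> y) * (norm (y - m))\<^sup>2))"
      using int lin sq_m by auto
    have "exp (x \<bullet> y) * ((norm a)\<^sup>2 + real n * \<sigma>)
      + 2 * (exp (x \<bullet> y) * (a \<bullet> y) - exp (x \<bullet> y) * (a \<bullet> m)) + exp (x \<bullet> y) * (norm (y - m))\<^sup>2
      = exp (x \<bullet> y) * ((norm (a + (y - m)))\<^sup>2 + real n * \<sigma>)" for y
      by (simp add: dot_square_norm[symmetric] inner_add_left inner_add_right inner_diff_left inner_diff_right inner_commute algebra_simps)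
    then show "AE y in \<mu>. 0 \<le> mgf x ^ n * (exp (x \<bullet> y) * ((norm a)\<^sup>2 + real n * \<sigma>)
      + 2 * (exp (x \<bullet> y) * (a \<bullet> y) - exp (x \<bullet> y) * (a \<bullet> m)) + exp (x \<bullet> y) * (norm (y - m))\<^sup>2)"
      using L \<sigma> by simp
  qed
  also have "(LINT y|\<mu>. mgf x ^ n * (exp (x \<bullet> y) * ((norm a)\<^sup>2 + real n * \<sigma>)
      + 2 * (exp (x \<bullet> y) * (a \<bullet> y) - exp (x \<bullet> y) * (a \<bullet> m)) + exp (x \<bullet> y) * (norm (y - m))\<^sup>2))
    = mgf x ^ n * (mgf x * ((norm a)\<^sup>2 + real n * \<sigma>)
      + 2 * (a \<bullet> (mgf_gradient x - mgf x *\<^sub>R m)) + (LINT y|\<mu>. exp (x \<bullet> y) * (norm (y - m))\<^sup>2))"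
    using int lin sq_m by (simp add: mgf_def inner_mgf_gradient[OF int sq] inner_diff_right)
  also have "\<dots> = mgf x ^ Suc n * ((norm a)\<^sup>2 + real (Suc n) * \<sigma>)"
    using L by (simp add: m_def \<sigma>_def field_simps)
  finally show ?case .
qed

text \<open>Chebyshev's inequality under the tilted law puts at least half of the mass near \<open>n m\<close>. There the
weight \<open>exp (x \<bullet> position n \<omega>)\<close> is bounded, which turns the statement into one on untilted
probabilities.\<close>

lemma tilted_weak_law:
  fixes x :: 'a
  assumes int: "integrable \<mu> (\<lambda>y. exp (x \<bullet> y))" and sq: "integrable \<mu> (\<lambda>y. exp (x \<bullet> y) * (norm y)\<^sup>2)"
    and \<eta>: "\<eta> > 0"
  defines "m \<equiv> mgf_gradient x /\<^sub>R mgf x"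
  shows "eventually (\<lambda>n. mgf x ^ n / 2 \<le> exp (real n * (x \<bullet> m + norm x * \<eta>))
    * measure paths {\<omega>. norm (position n \<omega> - real n *\<^sub>R m) \<le> real n * \<eta>}) sequentially"
proof -
  define \<sigma> where "\<sigma> = (LINT y|\<mu>. exp (x \<bullet> y) * (norm (y - m))\<^sup>2) / mgf x"
  note L = mgf_pos[OF int]
  have \<sigma>: "\<sigma> \<ge> 0"
    unfolding \<sigma>_def using L by simp
  obtain n1 where n1: "2 * \<sigma> / \<eta>\<^sup>2 \<le> real n1"
    using real_arch_simple by blast
  have "mgf x ^ n / 2 \<le> exp (real n * (x \<bullet> m + norm x * \<eta>))
    * measure paths {\<omega>. norm (position n \<omega> - real n *\<^sub>R m) \<le> real n * \<eta>}"
    if n: "n \<ge> Suc n1" for n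
  proof -
    define E where "E = exp (real n * (x \<bullet> m + norm x * \<eta>))"
    define G where "G = {\<omega>. norm (position n \<omega> - real n *\<^sub>R m) \<le> real n * \<eta>}"
    define c where "c = 1 / (real n * \<eta>)\<^sup>2"
    have "{\<omega> \<in> space paths. norm (position n \<omega> - real n *\<^sub>R m) \<le> real n * \<eta>} \<in> sets paths"
      by measurable
    then have G[measurable]: "G \<in> sets paths" by (simp add: G_def)
    have n\<eta>: "real n * \<eta> > 0"
      using n \<eta> by simp
    define Q where "Q \<omega> = exp (x \<bullet> position n \<omega>) * (norm (position n \<omega> - real n *\<^sub>R m))\<^sup>2" for \<omega>
    have Q[measurable]: "Q \<in> borel_measurable paths" and Q_nonneg: "\<And>\<omega>. 0 \<le> Q \<omega>"
      unfolding Q_def by simp_all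
    have second_moment: "(\<integral>\<^sup>+\<omega>. ennreal (Q \<omega>) \<partial>paths) = ennreal (mgf x ^ n * (real n * \<sigma>))"
      using tilted_second_moment[OF int sq, folded m_def, folded \<sigma>_def, of n 0] by (simp add: Q_def)
    have E: "E \<ge> 0" and c: "c \<ge> 0"
      by (simp_all add: E_def c_def)
    have pointwise: "exp (x \<bullet> position n \<omega>) \<le> E * indicator G \<omega>
        + c * Q \<omega>" for \<omega>
    proof (cases "\<omega> \<in> G")
      case True
      have "x \<bullet> position n \<omega> = real n * (x \<bullet> m) + x \<bullet> (position n \<omega> - real n *\<^sub>R m)"
        by (simp add: inner_diff_right)
      also have "x \<bullet> (position n \<omega> - real n *\<^sub>R m) \<le> norm x * norm (position n \<omega> - real n *\<^sub>R m)"
        by (rule norm_cauchy_schwarz)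
      also have "\<dots> \<le> norm x * (real n * \<eta>)"
        using True by (intro mult_left_mono) (auto simp: G_def)
      finally have "exp (x \<bullet> position n \<omega>) \<le> E"
        by (simp add: E_def algebra_simps)
      then show ?thesis
        using True c Q_nonneg by (simp add: add_increasing2)
    next
      case False
      then have "(real n * \<eta>)\<^sup>2 \<le> (norm (position n \<omega> - real n *\<^sub>R m))\<^sup>2"
        using n\<eta> by (intro power_mono) (auto simp: G_def)
      then have "1 \<le> (norm (position n \<omega> - real n *\<^sub>R m))\<^sup>2 / (real n * \<eta>)\<^sup>2"
        by (rule le_divide_eq_1_pos[THEN iffD2, OF zero_less_power[OF n\<eta>]])
      then have "1 \<le> c * (norm (position n \<omega> - real n *\<^sub>R m))\<^sup>2"
        by (simp add: c_def)
      then have "exp (x \<bullet> position n \<omega>) * 1 \<le> exp (x \<bullet> position n \<omega>) * (c * (norm (position n \<omega> - real n *\<^sub>R m))\<^sup>2)"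
        by (intro mult_left_mono) auto
      then show ?thesis
        using False by (simp add: Q_def mult_ac)
    qed
    have "ennreal (mgf x ^ n) = (\<integral>\<^sup>+\<omega>. ennreal (exp (x \<bullet> position n \<omega>)) \<partial>paths)"
      unfolding nn_integral_exp_position laplace_transform_eq_mgf[OF int] using L by (simp add: ennreal_power)
    also have "\<dots> \<le> (\<integral>\<^sup>+\<omega>. ennreal E * indicator G \<omega>
        + ennreal c * ennreal (Q \<omega>) \<partial>paths)"
    proof (rule nn_integral_mono)
      fix \<omega>
      have "ennreal (exp (x \<bullet> position n \<omega>)) \<le> ennreal (E * indicator G \<omega>
        + c * Q \<omega>)"
        using pointwise by (rule ennreal_leI)
      also have "\<dots> = ennreal E * indicator G \<omega>
        + ennreal c * ennreal (Q \<omega>)"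
        using E c Q_nonneg by (simp add: ennreal_mult ennreal_indicator)
      finally show "ennreal (exp (x \<bullet> position n \<omega>)) \<le> ennreal E * indicator G \<omega>
        + ennreal c * ennreal (Q \<omega>)" .
    qed
    also have "\<dots> = ennreal E * emeasure paths G + ennreal c * ennreal (mgf x ^ n * (real n * \<sigma>))"
      unfolding second_moment[symmetric] by (subst nn_integral_add) (simp_all add: nn_integral_cmult)
    also have "\<dots> = ennreal (E * measure paths G + c * (mgf x ^ n * (real n * \<sigma>)))"
      using L \<sigma> E c by (simp add: seq.P.emeasure_eq_measure ennreal_mult)
    finally have le: "mgf x ^ n \<le> E * measure paths G + c * (mgf x ^ n * (real n * \<sigma>))"
      using L \<sigma> E c by (subst (asm) ennreal_le_iff) auto
    have "c * (real n * \<sigma>) \<le> 1 / 2"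
    proof -
      have "2 * \<sigma> \<le> real n1 * \<eta>\<^sup>2"
        using n1 \<eta> by (simp add: field_simps)
      also have "\<dots> \<le> real n * \<eta>\<^sup>2"
        using n by (intro mult_right_mono) auto
      finally have "2 * \<sigma> * real n \<le> real n * \<eta>\<^sup>2 * real n"
        by (intro mult_right_mono) auto
      then have "real n * \<sigma> \<le> 1 / 2 * (real n * \<eta>)\<^sup>2"
        by (simp add: power2_eq_square mult_ac)
      then have "real n * \<sigma> / (real n * \<eta>)\<^sup>2 \<le> 1 / 2"
        by (rule pos_divide_le_eq[THEN iffD2, OF zero_less_power[OF n\<eta>]])
      then show ?thesis
        by (simp add: c_def)
    qed
    then have "mgf x ^ n * (c * (real n * \<sigma>)) \<le> mgf x ^ n * (1 / 2)"
      using L by (intro mult_left_mono) auto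
    with le show ?thesis
      by (simp add: E_def G_def mult_ac)
  qed
  then show ?thesis
    unfolding eventually_sequentially by blast
qed

end

section \<open>Tilting the drift into the interior of the cone\<close>

lemma bipolar_closed_convex_cone:
  fixes K :: "'a::euclidean_space set"
  assumes K: "convex_cone K" and "closed K" and w: "\<And>z. z \<in> dual_cone K \<Longrightarrow> 0 \<le> w \<bullet> z"
  shows "w \<in> K"
proof (rule ccontr)
  assume "w \<notin> K"
  then obtain a b where ab: "a \<bullet> w < b" "\<And>x. x \<in> K \<Longrightarrow> b < a \<bullet> x"
    using separating_hyperplane_closed_point[of K w] K \<open>closed K\<close> unfolding convex_cone_def by blast
  have "b < 0"
    using ab(2)[OF convex_cone_contains_0[OF K]] by simp
  have "a \<in> dual_cone K"
    unfolding dual_cone_def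
  proof (intro CollectI ballI, rule ccontr)
    fix x assume x: "x \<in> K" "\<not> 0 \<le> x \<bullet> a"
    have "(b / (x \<bullet> a)) *\<^sub>R x \<in> K"
      using x \<open>b < 0\<close> by (intro convex_cone_scaleR[OF K]) (auto simp: divide_nonpos_neg)
    from ab(2)[OF this] x(2) show False
      by (simp add: inner_commute)
  qed
  with w[of a] ab(1) \<open>b < 0\<close> show False
    by (simp add: inner_commute)
qed

lemma dual_cone_convex_cone: "convex_cone (dual_cone K)"
  by (auto simp: convex_cone_iff dual_cone_def inner_add_right)

lemma closed_dual_cone: "closed (dual_cone K)"
proof -
  have "dual_cone K = (\<Inter>x\<in>K. {z. x \<bullet> z \<ge> 0})"
    by (auto simp: dual_cone_def)
  then show ?thesis
    by (auto intro!: closed_INT closed_halfspace_ge)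
qed

context random_increments
begin

lemma AE_inner_eq_0_imp_degenerate:
  assumes non_degenerate: "\<And>H. linear_hyperplane H \<Longrightarrow> \<not> measure_support \<mu> \<subseteq> H"
    and ae: "AE y in \<mu>. a \<bullet> y = 0"
  shows "a = 0"
proof (rule ccontr)
  assume a: "a \<noteq> 0"
  define H where "H = {y. a \<bullet> y = 0}"
  have "linear_hyperplane H"
    unfolding linear_hyperplane_def H_def using a by (simp add: subspace_hyperplane dim_hyperplane)
  moreover have "measure_support \<mu> \<subseteq> H"
  proof
    fix y assume y: "y \<in> measure_support \<mu>"
    show "y \<in> H"
    proof (rule ccontr)
      assume "y \<notin> H"
      moreover have "open (- H)"
        unfolding H_def by (simp add: open_Compl closed_hyperplane)
      ultimately have "0 < emeasure \<mu> (- H)"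
        using y by (auto simp: measure_support_def)
      moreover have "emeasure \<mu> (- H) = 0"
      proof -
        have "- H \<in> sets \<mu>"
          using \<open>open (- H)\<close> by (simp add: sets_eq_borel)
        moreover have "- H = {y \<in> space \<mu>. \<not> a \<bullet> y = 0}"
          by (auto simp: H_def)
        ultimately show ?thesis
          using ae by (subst (asm) AE_iff_measurable[of "- H"]) auto
      qed
      ultimately show False by simp
    qed
  qed
  ultimately show False using non_degenerate by blast
qed

text \<open>Strict convexity. The deficit at the midpoint is half the integral of the square of
\<open>exp (x \<bullet> y / 2) - exp (x' \<bullet> y / 2)\<close>, which vanishes only if the increments almost surely lie
in the hyperplane orthogonal to \<open>x - x'\<close>.\<close>

lemma mgf_midpoint_less:
  assumes non_degenerate: "\<And>H. linear_hyperplane H \<Longrightarrow> \<not> measure_support \<mu> \<subseteq> H"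
    and int: "integrable \<mu> (\<lambda>y. exp (x \<bullet> y))" "integrable \<mu> (\<lambda>y. exp (x' \<bullet> y))"
      "integrable \<mu> (\<lambda>y. exp (((1/2) *\<^sub>R (x + x')) \<bullet> y))"
    and "x \<noteq> x'"
  shows "mgf ((1/2) *\<^sub>R (x + x')) < (mgf x + mgf x') / 2"
proof -
  let ?h = "\<lambda>y. exp (x \<bullet> y) + exp (x' \<bullet> y) - 2 * exp (((1/2) *\<^sub>R (x + x')) \<bullet> y)"
  have h: "?h y = (exp (x \<bullet> y / 2) - exp (x' \<bullet> y / 2))\<^sup>2" for y
    by (simp add: power2_diff exp_double[symmetric] mult_exp_exp inner_add_left add_divide_distrib mult.assoc)
  have inth: "integrable \<mu> ?h"
    using int by auto
  have "(LINT y|\<mu>. ?h y) \<noteq> 0"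
  proof
    assume "(LINT y|\<mu>. ?h y) = 0"
    then have "AE y in \<mu>. ?h y = 0"
      by (subst (asm) integral_nonneg_eq_0_iff_AE[OF inth]) (simp_all only: h zero_le_power2 AE_I2)
    then have "AE y in \<mu>. (x - x') \<bullet> y = 0"
      unfolding h by eventually_elim (simp add: inner_diff_left)
    from AE_inner_eq_0_imp_degenerate[OF non_degenerate this] \<open>x \<noteq> x'\<close> show False by simp
  qed
  moreover have "(LINT y|\<mu>. ?h y) \<ge> 0"
    unfolding h by simp
  moreover have "(LINT y|\<mu>. ?h y) = mgf x + mgf x' - 2 * mgf ((1/2) *\<^sub>R (x + x'))"
    unfolding mgf_def using int by simp
  ultimately show ?thesis by simp
qed

lemma continuous_on_mgf:
  assumes "open U" "convex U" and int: "\<And>z. z \<in> U \<Longrightarrow> integrable \<mu> (\<lambda>y. exp (z \<bullet> y))"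
  shows "continuous_on U mgf"
proof (rule convex_on_continuous[OF \<open>open U\<close>], rule convex_onI[OF _ \<open>convex U\<close>])
  fix t :: real and x y
  assume t: "0 < t" "t < 1" and xy: "x \<in> U" "y \<in> U"
  have mem: "(1 - t) *\<^sub>R x + t *\<^sub>R y \<in> U"
    using \<open>convex U\<close> xy t by (simp add: convex_def)
  have "mgf ((1 - t) *\<^sub>R x + t *\<^sub>R y) \<le> (LINT w|\<mu>. (1 - t) * exp (x \<bullet> w) + t * exp (y \<bullet> w))"
    unfolding mgf_def
  proof (rule integral_mono[OF int[OF mem]])
    show "integrable \<mu> (\<lambda>w. (1 - t) * exp (x \<bullet> w) + t * exp (y \<bullet> w))"
      using int xy by auto
    show "exp (((1 - t) *\<^sub>R x + t *\<^sub>R y) \<bullet> w) \<le> (1 - t) * exp (x \<bullet> w) + t * exp (y \<bullet> w)" for w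
      using convex_onD[OF exp_convex, of t "x \<bullet> w" "y \<bullet> w"] t by (simp add: inner_add_left)
  qed
  also have "\<dots> = (1 - t) * mgf x + t * mgf y"
    unfolding mgf_def using int xy by simp
  finally show "mgf ((1 - t) *\<^sub>R x + t *\<^sub>R y) \<le> (1 - t) * mgf x + t * mgf y" .
qed

text \<open>The conditions at the minimum \<open>xstar\<close> only place the gradient in \<open>K\<close>, possibly on its boundary.
Minimising the perturbed function \<open>mgf x - \<epsilon> * (x \<bullet> v)\<close> over the dual cone near \<open>xstar\<close> moves it into
the interior: variation in the directions of the dual cone and the bipolar theorem give a gradient in
\<open>K + \<epsilon> v\<close>. Variation along the ray through \<open>x\<close>, in the direction of the origin, shows that the cost
\<open>x \<bullet> mgf_gradient x\<close> of the tilt is of order \<open>\<epsilon>\<close>. The value of \<open>mgf\<close> cannot have dropped, since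
\<open>xstar\<close> is a minimum. Strict convexity keeps the perturbed minimum away from the boundary of the ball.\<close>

lemma exists_tilt_into_cone:
  fixes K V :: "'a set" and v xstar :: 'a
  assumes K: "convex_cone K" "closed K"
    and non_degenerate: "\<And>H. linear_hyperplane H \<Longrightarrow> \<not> measure_support \<mu> \<subseteq> H"
    and xstar: "xstar \<in> dual_cone K" "xstar \<in> V" and "open V"
    and fin: "\<And>x. x \<in> V \<Longrightarrow> integrable \<mu> (\<lambda>y. exp (x \<bullet> y))"
    and min: "\<And>x. x \<in> dual_cone K \<inter> V \<Longrightarrow> mgf xstar \<le> mgf x"
    and "e > 0"
  obtains x \<epsilon> where "x \<in> V" "\<epsilon> > 0" "mgf xstar \<le> mgf x" "mgf_gradient x - \<epsilon> *\<^sub>R v \<in> K"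
    "x \<bullet> mgf_gradient x \<le> e"
proof -
  let ?Q = "dual_cone K"
  obtain r where r: "r > 0" "ball xstar r \<subseteq> V"
    using \<open>open V\<close> xstar(2) openE by blast
  define \<rho> where "\<rho> = r / 2"
  have \<rho>: "\<rho> > 0" "\<rho> < r"
    using r(1) by (auto simp: \<rho>_def)
  then have cball: "cball xstar \<rho> \<subseteq> ball xstar r"
    by auto
  have int: "integrable \<mu> (\<lambda>y. exp (z \<bullet> y))" if "z \<in> ball xstar r" for z
    using fin r(2) that by blast
  have cont: "continuous_on (ball xstar r) mgf"
    using int by (intro continuous_on_mgf) auto
  have strict: "mgf xstar < mgf x" if x: "x \<in> ?Q" "x \<in> cball xstar \<rho>" "x \<noteq> xstar" for x
  proof -
    let ?h = "(1/2) *\<^sub>R (x + xstar)"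
    have "?h \<in> ?Q"
      using x(1) xstar(1) by (intro convex_cone_scaleR convex_cone_add dual_cone_convex_cone) auto
    moreover have "?h \<in> ball xstar r"
    proof -
      have "(1/2) *\<^sub>R x + (1/2) *\<^sub>R xstar \<in> ball xstar r"
        using x(2) cball r(1) by (intro convexD[OF convex_ball]) auto
      then show ?thesis by (simp add: scaleR_add_right)
    qed
    ultimately have "mgf xstar \<le> mgf ?h" "integrable \<mu> (\<lambda>y. exp (?h \<bullet> y))"
      using min int r(2) by blast+
    with mgf_midpoint_less[OF non_degenerate int int this(2) x(3)] x(2) cball r(1)
    show ?thesis by (auto simp: subset_iff)
  qed
  have "\<exists>c>0. \<forall>x\<in>?Q \<inter> sphere xstar \<rho>. mgf xstar + c \<le> mgf x"
  proof (cases "?Q \<inter> sphere xstar \<rho> = {}")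
    case True
    then show ?thesis by (intro exI[of _ 1]) auto
  next
    case False
    have "compact (?Q \<inter> sphere xstar \<rho>)"
      by (intro closed_Int_compact closed_dual_cone compact_sphere)
    moreover have "continuous_on (?Q \<inter> sphere xstar \<rho>) mgf"
      using cball by (intro continuous_on_subset[OF cont]) auto
    ultimately obtain x1 where x1: "x1 \<in> ?Q \<inter> sphere xstar \<rho>" "\<And>x. x \<in> ?Q \<inter> sphere xstar \<rho> \<Longrightarrow> mgf x1 \<le> mgf x"
      using False continuous_attains_inf[of "?Q \<inter> sphere xstar \<rho>" mgf] by blast
    have "mgf xstar < mgf x1"
      using x1(1) \<rho>(1) by (intro strict) auto
    with x1(2) show ?thesis
      by (intro exI[of _ "mgf x1 - mgf xstar"]) auto
  qed
  then obtain c where c: "c > 0" "\<And>x. x \<in> ?Q \<inter> sphere xstar \<rho> \<Longrightarrow> mgf xstar + c \<le> mgf x"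
    by blast
  \<comment> \<open>The bound on \<open>\<epsilon> * B\<close> by \<open>c\<close> makes the perturbation too small to move the minimum to the sphere;
    the bound by \<open>e\<close> limits the cost of the tilt.\<close>
  define B where "B = (norm xstar + \<rho>) * norm v + 1"
  define \<epsilon> where "\<epsilon> = Min {c, e} / B"
  have B: "B > 0"
    unfolding B_def using \<rho>(1) by (intro add_nonneg_pos mult_nonneg_nonneg add_nonneg_nonneg) auto
  have \<epsilon>: "\<epsilon> > 0" "\<epsilon> * B \<le> c" "\<epsilon> * B \<le> e"
    using B c(1) \<open>e > 0\<close> by (auto simp: \<epsilon>_def)
  define F where "F x = mgf x - \<epsilon> * (x \<bullet> v)" for x
  have "compact (?Q \<inter> cball xstar \<rho>)"
    by (intro closed_Int_compact closed_dual_cone compact_cball)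
  moreover have "xstar \<in> ?Q \<inter> cball xstar \<rho>"
    using xstar \<rho> by auto
  moreover have "continuous_on (?Q \<inter> cball xstar \<rho>) F"
    unfolding F_def using cball by (intro continuous_intros continuous_on_subset[OF cont]) auto
  ultimately obtain x where x: "x \<in> ?Q" "x \<in> cball xstar \<rho>"
    and x_min: "\<And>z. z \<in> ?Q \<inter> cball xstar \<rho> \<Longrightarrow> F x \<le> F z"
    using continuous_attains_inf[of "?Q \<inter> cball xstar \<rho>" F] by blast
  have x_ball: "dist xstar x < \<rho>"
  proof (rule ccontr)
    assume "\<not> ?thesis"
    then have "x \<in> ?Q \<inter> sphere xstar \<rho>"
      using x by auto
    then have "mgf xstar + c \<le> mgf x" by (rule c(2))
    moreover have "F x \<le> F xstar"
      using xstar \<rho> by (intro x_min) auto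
    ultimately have "c \<le> \<epsilon> * ((x - xstar) \<bullet> v)"
      by (simp add: F_def algebra_simps)
    also have "\<dots> \<le> \<epsilon> * (\<rho> * norm v)"
    proof (rule mult_left_mono)
      have "(x - xstar) \<bullet> v \<le> norm (x - xstar) * norm v"
        by (rule norm_cauchy_schwarz)
      also have "\<dots> \<le> \<rho> * norm v"
        using x(2) by (intro mult_right_mono) (auto simp: dist_norm norm_minus_commute)
      finally show "(x - xstar) \<bullet> v \<le> \<rho> * norm v" .
    qed (use \<epsilon> in simp)
    also have "\<dots> < \<epsilon> * B"
      using \<epsilon>(1) by (intro mult_strict_left_mono) (auto simp: B_def distrib_right add_nonneg_pos add_strict_increasing2)
    also have "\<dots> \<le> c" by (rule \<epsilon>(2))
    finally show False by simp
  qed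
  have "x \<in> V" and x_int: "integrable \<mu> (\<lambda>y. exp (x \<bullet> y))"
    using x(2) cball r(2) int by auto
  have "ball x (r - \<rho>) \<subseteq> ball xstar r"
  proof
    fix z assume "z \<in> ball x (r - \<rho>)"
    then show "z \<in> ball xstar r"
      using x(2) dist_triangle[of xstar z x] by simp
  qed
  then have "\<And>z. z \<in> ball x (r - \<rho>) \<Longrightarrow> laplace_transform \<mu> z < \<infinity>"
    using int integrable_exp_inner_iff by blast
  then obtain s where s: "s > 0" "integrable \<mu> (\<lambda>y. exp (x \<bullet> y) * exp (s * norm y))"
    using integrable_exp_inner_norm[of "r - \<rho>" x] \<rho>(2) by auto
  define C where "C = 8 / s\<^sup>2 * (LINT y|\<mu>. exp (x \<bullet> y) * exp (s * norm y))"
  have variation: "\<epsilon> * (z \<bullet> v) \<le> z \<bullet> mgf_gradient x"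
    if z: "\<And>t. 0 \<le> t \<Longrightarrow> t \<le> 1 \<Longrightarrow> x + t *\<^sub>R z \<in> ?Q" for z
  proof (rule tendsto_lowerbound)
    show "((\<lambda>t. z \<bullet> mgf_gradient x + t * ((norm z)\<^sup>2 * C)) \<longlongrightarrow> z \<bullet> mgf_gradient x) (at_right 0)"
      by (auto intro!: tendsto_eq_intros)
    have "((\<lambda>t. dist xstar (x + t *\<^sub>R z)) \<longlongrightarrow> dist xstar x) (at_right 0)"
      by (auto intro!: tendsto_eq_intros)
    then have 1: "\<forall>\<^sub>F t in at_right 0. dist xstar (x + t *\<^sub>R z) < \<rho>"
      using x_ball by (rule order_tendstoD)
    have "((\<lambda>t. norm (t *\<^sub>R z)) \<longlongrightarrow> 0) (at_right 0)"
      by (auto intro!: tendsto_eq_intros)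
    then have 2: "\<forall>\<^sub>F t in at_right 0. norm (t *\<^sub>R z) < s / 2"
      using s(1) by (intro order_tendstoD(2)) auto
    have 3: "\<forall>\<^sub>F t in at_right 0. 0 < t \<and> t < (1::real)"
      by (auto simp: eventually_at_right_field intro!: exI[of _ 1])
    show "\<forall>\<^sub>F t in at_right 0. \<epsilon> * (z \<bullet> v) \<le> z \<bullet> mgf_gradient x + t * ((norm z)\<^sup>2 * C)"
      using 1 2 3
    proof eventually_elim
      case (elim t)
      have "F x \<le> F (x + t *\<^sub>R z)"
        using elim z[of t] by (intro x_min) auto
      then have "mgf x + t * (\<epsilon> * (z \<bullet> v)) \<le> mgf (x + t *\<^sub>R z)"
        by (simp add: F_def inner_add_left algebra_simps)
      also have "\<dots> \<le> mgf x + (t *\<^sub>R z) \<bullet> mgf_gradient x + (norm (t *\<^sub>R z))\<^sup>2 * C"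
        unfolding C_def using elim by (intro mgf_second_order_bound[OF s x_int]) auto
      finally have "t * (\<epsilon> * (z \<bullet> v)) \<le> t * (z \<bullet> mgf_gradient x + t * ((norm z)\<^sup>2 * C))"
        by (simp add: power_mult_distrib algebra_simps power2_eq_square)
      then show ?case
        using elim by (simp add: mult_le_cancel_left)
    qed
  qed simp
  show thesis
  proof (rule that[OF \<open>x \<in> V\<close> \<epsilon>(1)])
    show "mgf xstar \<le> mgf x"
      using x(1) \<open>x \<in> V\<close> by (intro min) auto
    show "mgf_gradient x - \<epsilon> *\<^sub>R v \<in> K"
    proof (rule bipolar_closed_convex_cone[OF K])
      fix z assume "z \<in> ?Q"
      then have "\<epsilon> * (z \<bullet> v) \<le> z \<bullet> mgf_gradient x"
        using x(1) by (intro variation convex_cone_add convex_cone_scaleR dual_cone_convex_cone)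
      then show "0 \<le> (mgf_gradient x - \<epsilon> *\<^sub>R v) \<bullet> z"
        by (subst inner_commute) (simp add: inner_diff_right)
    qed
    have "\<epsilon> * ((- x) \<bullet> v) \<le> (- x) \<bullet> mgf_gradient x"
    proof (rule variation)
      fix t :: real assume "0 \<le> t" "t \<le> 1"
      then have "(1 - t) *\<^sub>R x \<in> ?Q"
        using x(1) by (intro convex_cone_scaleR dual_cone_convex_cone) auto
      then show "x + t *\<^sub>R (- x) \<in> ?Q"
        by (simp add: algebra_simps)
    qed
    then have "x \<bullet> mgf_gradient x \<le> \<epsilon> * (x \<bullet> v)" by simp
    also have "\<dots> \<le> \<epsilon> * B"
    proof (rule mult_left_mono)
      have "x \<bullet> v \<le> norm x * norm v"
        by (rule norm_cauchy_schwarz)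
      also have "norm x \<le> norm xstar + \<rho>"
        using norm_triangle_ineq[of xstar "x - xstar"] x(2) by (simp add: dist_norm norm_minus_commute)
      then have "norm x * norm v \<le> (norm xstar + \<rho>) * norm v"
        by (rule mult_right_mono) simp
      finally show "x \<bullet> v \<le> B" by (simp add: B_def)
    qed (use \<epsilon> in simp)
    also have "\<dots> \<le> e" by (rule \<epsilon>(3))
    finally show "x \<bullet> mgf_gradient x \<le> e" .
  qed
qed

text \<open>After the tilt the walk follows a drift \<open>m\<close> in the interior of the cone and so lies in \<open>K\<close> at late
times with probability at least one half. Undoing the tilt costs a factor \<open>exp (N t / 2)\<close>, and the
remaining \<open>exp (N t / 2)\<close> of the allowance dominates the factor two.\<close>

lemma cone_visit_probability:
  fixes K V :: "'a set" and v xstar :: 'a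
  assumes K: "convex_cone K" "closed K" and v: "v \<in> interior K"
    and non_degenerate: "\<And>H. linear_hyperplane H \<Longrightarrow> \<not> measure_support \<mu> \<subseteq> H"
    and xstar: "xstar \<in> dual_cone K" "xstar \<in> V" and "open V"
    and fin: "\<And>x. x \<in> V \<Longrightarrow> laplace_transform \<mu> x < \<infinity>"
    and min: "\<And>x. x \<in> dual_cone K \<inter> V \<Longrightarrow> mgf xstar \<le> mgf x"
    and "t > 0"
  shows "\<exists>N\<ge>1. (mgf xstar * exp (- t)) ^ N < measure paths {\<omega>. position N \<omega> \<in> K}"
proof -
  have int: "integrable \<mu> (\<lambda>y. exp (x \<bullet> y))" if "x \<in> V" for x
    using fin that by (simp add: integrable_exp_inner_iff)
  have Ls: "mgf xstar > 0"
    using xstar(2) by (intro mgf_pos int)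
  then have "t / 4 * mgf xstar > 0"
    using \<open>t > 0\<close> by simp
  then obtain x \<epsilon> where x: "x \<in> V" and \<epsilon>: "\<epsilon> > 0" and L: "mgf xstar \<le> mgf x"
    and grad: "mgf_gradient x - \<epsilon> *\<^sub>R v \<in> K" and cost: "x \<bullet> mgf_gradient x \<le> t / 4 * mgf xstar"
    using exists_tilt_into_cone[OF K non_degenerate xstar \<open>open V\<close> int min] by blast
  define m where "m = mgf_gradient x /\<^sub>R mgf x"
  define \<epsilon>' where "\<epsilon>' = \<epsilon> / mgf x"
  have L0: "mgf x > 0" using L Ls by simp
  have \<epsilon>': "\<epsilon>' > 0" using \<epsilon> L0 by (simp add: \<epsilon>'_def)
  have m: "m - \<epsilon>' *\<^sub>R v \<in> K"
    using convex_cone_scaleR[OF K(1) _ grad, of "1 / mgf x"] L0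
    by (simp add: m_def \<epsilon>'_def scaleR_diff_right divide_inverse mult.commute)
  have xm: "x \<bullet> m \<le> t / 4"
  proof -
    have "t / 4 * mgf xstar \<le> t / 4 * mgf x"
      using \<open>t > 0\<close> by (intro mult_left_mono[OF L]) simp
    with cost have "x \<bullet> mgf_gradient x \<le> t / 4 * mgf x"
      by (rule order_trans)
    then show ?thesis
      using L0 by (simp add: m_def field_simps)
  qed
  obtain e where e: "e > 0" "\<And>w c. norm w \<le> e * c \<Longrightarrow> w + c *\<^sub>R v \<in> K"
    using convex_cone_absorbs[OF K(1) v] by blast
  define \<eta> where "\<eta> = min (e * \<epsilon>') (t / (4 * (norm x + 1)))"
  have nx: "norm x + 1 > 0"
    using norm_ge_zero[of x] by linarith
  have \<eta>: "\<eta> > 0" "\<eta> \<le> e * \<epsilon>'" "norm x * \<eta> \<le> t / 4"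
  proof -
    show "\<eta> > 0" "\<eta> \<le> e * \<epsilon>'"
      using e \<epsilon>' \<open>t > 0\<close> nx by (auto simp: \<eta>_def)
    have "norm x * \<eta> \<le> (norm x + 1) * (t / (4 * (norm x + 1)))"
      using \<open>\<eta> > 0\<close> nx by (intro mult_mono) (auto simp: \<eta>_def)
    also have "\<dots> = t / 4"
      using nx by (simp add: field_simps)
    finally show "norm x * \<eta> \<le> t / 4" .
  qed
  obtain r where r: "r > 0" "ball x r \<subseteq> V"
    using \<open>open V\<close> x openE by blast
  then obtain s where s: "s > 0" "integrable \<mu> (\<lambda>y. exp (x \<bullet> y) * exp (s * norm y))"
    using integrable_exp_inner_norm[of r x] fin by blast
  have "\<forall>\<^sub>F n in sequentially. mgf x ^ n / 2 \<le> exp (real n * (x \<bullet> m + norm x * \<eta>))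
    * measure paths {\<omega>. norm (position n \<omega> - real n *\<^sub>R m) \<le> real n * \<eta>}"
    unfolding m_def by (rule tilted_weak_law[OF int[OF x] integrable_exp_inner_square[OF s] \<eta>(1)])
  moreover have "\<forall>\<^sub>F n in sequentially. 2 / t < real n"
    using filterlim_real_sequentially by (simp add: filterlim_at_top_dense)
  moreover have "\<forall>\<^sub>F n in sequentially. n \<ge> (1::nat)"
    by (rule eventually_ge_at_top)
  ultimately have "\<forall>\<^sub>F N in sequentially. N \<ge> 1 \<and>
      (mgf xstar * exp (- t)) ^ N < measure paths {\<omega>. position N \<omega> \<in> K}"
  proof eventually_elim
    case (elim N)
    let ?p = "measure paths {\<omega>. position N \<omega> \<in> K}"
    have near: "measure paths {\<omega>. norm (position N \<omega> - real N *\<^sub>R m) \<le> real N * \<eta>} \<le> ?p"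
    proof (rule seq.P.finite_measure_mono)
      show "{\<omega>. norm (position N \<omega> - real N *\<^sub>R m) \<le> real N * \<eta>} \<subseteq> {\<omega>. position N \<omega> \<in> K}"
      proof safe
        fix \<omega> assume w: "norm (position N \<omega> - real N *\<^sub>R m) \<le> real N * \<eta>"
        also have "\<dots> \<le> real N * (e * \<epsilon>')"
          using \<eta>(2) by (rule mult_left_mono) simp
        finally have "(position N \<omega> - real N *\<^sub>R m) + (real N * \<epsilon>') *\<^sub>R v \<in> K"
          by (intro e(2)) (simp add: mult_ac)
        moreover have "real N *\<^sub>R (m - \<epsilon>' *\<^sub>R v) \<in> K"
          using m by (intro convex_cone_scaleR[OF K(1)]) auto
        ultimately have "((position N \<omega> - real N *\<^sub>R m) + (real N * \<epsilon>') *\<^sub>R v) + real N *\<^sub>R (m - \<epsilon>' *\<^sub>R v) \<in> K"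
          by (rule convex_cone_add[OF K(1)])
        then show "position N \<omega> \<in> K"
          by (simp add: algebra_simps)
      qed
      have [measurable]: "K \<in> sets borel"
        using K(2) by (rule borel_closed)
      have "{\<omega> \<in> space paths. position N \<omega> \<in> K} \<in> sets paths"
        by measurable
      then show "{\<omega>. position N \<omega> \<in> K} \<in> sets paths" by simp
    qed
    have "mgf x ^ N / 2 \<le> exp (real N * (x \<bullet> m + norm x * \<eta>)) *
        measure paths {\<omega>. norm (position N \<omega> - real N *\<^sub>R m) \<le> real N * \<eta>}"
      using elim by blast
    also have "\<dots> \<le> exp (real N * (t / 2)) * ?p"
    proof (rule mult_mono[OF _ near])
      have "real N * (x \<bullet> m + norm x * \<eta>) \<le> real N * (t / 2)"
        using xm \<eta>(3) by (intro mult_left_mono) auto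
      then show "exp (real N * (x \<bullet> m + norm x * \<eta>)) \<le> exp (real N * (t / 2))"
        by simp
    qed simp_all
    finally have lower: "mgf x ^ N / 2 \<le> exp (real N * (t / 2)) * ?p" .
    have "2 < exp (real N * (t / 2))"
      using elim(2) \<open>t > 0\<close> exp_ge_add_one_self[of "real N * (t / 2)"] by (simp add: field_simps)
    then have "mgf x ^ N < exp (real N * (t / 2)) * (mgf x ^ N / 2)"
      using L0 by (simp add: field_simps)
    also have "\<dots> \<le> exp (real N * (t / 2)) * (exp (real N * (t / 2)) * ?p)"
      using lower by (rule mult_left_mono) simp
    also have "\<dots> = exp (real N * t) * ?p"
      by (simp add: mult_exp_exp mult.assoc[symmetric])
    finally have "mgf x ^ N * exp (- (real N * t)) < ?p"
      by (simp add: exp_minus field_simps)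
    moreover have "(mgf xstar * exp (- t)) ^ N \<le> mgf x ^ N * exp (- (real N * t))"
      unfolding power_mult_distrib exp_of_nat_mult[symmetric]
      using L Ls by (intro mult_mono power_mono) auto
    ultimately show ?case using elim by simp
  qed
  from eventually_happens'[OF sequentially_bot this] show ?thesis .
qed

end

section \<open>The exponential rate of the exit time\<close>

lemma root_tendsto_of_exponential_bounds:
  fixes a :: "nat \<Rightarrow> real"
  assumes L: "L > 0" and C: "C > 0" and upper: "\<And>n. a n \<le> C * L ^ n"
    and lower: "\<And>t. t > 0 \<Longrightarrow> \<exists>c>0. \<forall>n. c * (L * exp (- t)) ^ n \<le> a n"
  shows "(\<lambda>n. a n powr (1 / real n)) \<longlonglongrightarrow> L"
proof -
  have pos: "a n > 0" for n
  proof -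
    obtain c where "c > 0" "c * (L * exp (- 1)) ^ n \<le> a n"
      using lower[of 1] by auto
    with L show ?thesis
      by (smt (verit) exp_gt_zero mult_pos_pos zero_less_power)
  qed
  have "(\<lambda>n. ln (a n) / real n) \<longlonglongrightarrow> ln L"
  proof (rule order_tendstoI)
    fix b assume b: "b < ln L"
    define t where "t = (ln L - b) / 2"
    have t: "t > 0" and b_eq: "b = ln L - 2 * t" using b by (simp_all add: t_def field_simps)
    obtain c where c: "c > 0" "\<And>n. c * (L * exp (- t)) ^ n \<le> a n"
      using lower[OF t] by blast
    have "\<forall>\<^sub>F n in sequentially. - t < ln c / real n"
      using t by (intro order_tendstoD(1)[OF lim_const_over_n]) simp
    then show "\<forall>\<^sub>F n in sequentially. b < ln (a n) / real n"
      using eventually_gt_at_top[of 0]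
    proof eventually_elim
      case (elim n)
      have "ln c + real n * (ln L - t) = ln (c * (L * exp (- t)) ^ n)"
        using c(1) L by (simp add: ln_mult ln_realpow)
      also have "\<dots> \<le> ln (a n)"
        using c L pos by (subst ln_le_cancel_iff) auto
      finally have "(ln c + real n * (ln L - t)) / real n \<le> ln (a n) / real n"
        by (rule divide_right_mono) simp
      with elim show ?case by (simp add: b_eq add_divide_distrib)
    qed
  next
    fix b assume b: "ln L < b"
    have "\<forall>\<^sub>F n in sequentially. ln C / real n < b - ln L"
      using b by (intro order_tendstoD(2)[OF lim_const_over_n]) simp
    then show "\<forall>\<^sub>F n in sequentially. ln (a n) / real n < b"
      using eventually_gt_at_top[of 0]
    proof eventually_elim
      case (elim n)
      have "ln (a n) \<le> ln (C * L ^ n)"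
        using C L pos upper by (subst ln_le_cancel_iff) auto
      also have "\<dots> = ln C + real n * ln L"
        using C L by (simp add: ln_mult ln_realpow)
      finally have "ln (a n) / real n \<le> (ln C + real n * ln L) / real n"
        by (rule divide_right_mono) simp
      with elim show ?case by (simp add: add_divide_distrib)
    qed
  qed
  then have "(\<lambda>n. exp (ln (a n) / real n)) \<longlonglongrightarrow> exp (ln L)"
    by (rule tendsto_exp)
  then show ?thesis
    using L pos by (simp add: powr_def less_imp_neq[THEN not_sym])
qed

lemma mem_shift_along_iff: "y \<in> shift_along K v d \<longleftrightarrow> y - d *\<^sub>R v \<in> K"
proof
  assume "y - d *\<^sub>R v \<in> K"
  then have "(y - d *\<^sub>R v) + d *\<^sub>R v \<in> shift_along K v d"
    unfolding shift_along_def by (rule imageI)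
  then show "y \<in> shift_along K v d" by simp
qed (auto simp: shift_along_def)

text \<open>Markov's inequality: \<open>xstar\<close> is nonnegative on the cone, so its exponential dominates the indicator
of the event.\<close>

lemma (in random_increments) prob_stay_upper_bound:
  assumes "closed K" and xstar: "xstar \<in> dual_cone K" and x: "x \<in> K"
    and int: "integrable \<mu> (\<lambda>y. exp (xstar \<bullet> y))"
  shows "measure paths {\<omega>. \<forall>k\<in>{1..n}. x + position k \<omega> \<in> K} \<le> exp (xstar \<bullet> x) * mgf xstar ^ n"
proof -
  let ?A = "{\<omega>. \<forall>k\<in>{1..n}. x + position k \<omega> \<in> K}"
  have [measurable]: "K \<in> sets borel"
    using \<open>closed K\<close> by (rule borel_closed)
  have "{\<omega> \<in> space paths. \<forall>k\<in>{1..n}. x + position k \<omega> \<in> K} \<in> sets paths"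
    by measurable
  then have A: "?A \<in> sets paths" by simp
  have "emeasure paths ?A = (\<integral>\<^sup>+\<omega>. indicator ?A \<omega> \<partial>paths)"
    using A by simp
  also have "\<dots> \<le> (\<integral>\<^sup>+\<omega>. ennreal (exp (xstar \<bullet> x)) * ennreal (exp (xstar \<bullet> position n \<omega>)) \<partial>paths)"
  proof (rule nn_integral_mono)
    fix \<omega>
    have "1 \<le> exp (xstar \<bullet> (x + position n \<omega>))" if "\<omega> \<in> ?A"
    proof -
      have "x + position n \<omega> \<in> K"
        using that x by (cases n) auto
      then show ?thesis
        using xstar by (subst inner_commute) (simp add: dual_cone_def)
    qed
    then show "indicator ?A \<omega> \<le> ennreal (exp (xstar \<bullet> x)) * ennreal (exp (xstar \<bullet> position n \<omega>))"
      by (auto simp: indicator_def ennreal_mult'[symmetric] inner_add_right exp_add)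
  qed
  also have "\<dots> = ennreal (exp (xstar \<bullet> x) * mgf xstar ^ n)"
    using mgf_pos[OF int]
    by (simp add: nn_integral_cmult nn_integral_exp_position laplace_transform_eq_mgf[OF int] ennreal_power ennreal_mult)
  finally show ?thesis
    using mgf_pos[OF int] by (simp add: seq.P.emeasure_eq_measure)
qed

theorem proposition3:
  fixes K :: "(real ^ 'n) set"
    and v xstar :: "real ^ 'n"
    and V :: "(real ^ 'n) set"
    and \<mu> :: "(real ^ 'n) measure"
    and \<delta> :: real
    and P :: "real ^ 'n \<Rightarrow> 'w measure"
    and S :: "nat \<Rightarrow> 'w \<Rightarrow> real ^ 'n"
  assumes "convex_cone K" and "closed K" and "interior K \<noteq> {}"
    and "v \<in> interior K"
    and "prob_space \<mu>" and "sets \<mu> = sets borel"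
    and walk: "\<And>x. random_walk (P x) S \<mu> x"
    and non_degenerate: "\<And>H. linear_hyperplane H \<Longrightarrow> \<not> measure_support \<mu> \<subseteq> H"
    and "xstar \<in> dual_cone K" and "open V" and "xstar \<in> V"
    and laplace_finite: "\<And>x. x \<in> V \<Longrightarrow> laplace_transform \<mu> x < \<infinity>"
    and laplace_min:
      "\<And>x. x \<in> dual_cone K \<inter> V \<Longrightarrow> laplace_transform \<mu> xstar \<le> laplace_transform \<mu> x"
    and "0 \<le> \<delta>"
    and "\<exists>n0\<ge>1. measure (P 0) {\<omega> \<in> space (P 0).
           enat n0 < exit_time (shift_along K v (- \<delta>)) (\<lambda>k. S k \<omega>) \<and> S n0 \<omega> \<in> interior K} > 0"
  shows "\<forall>x \<in> shift_along K v \<delta>.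
    (\<lambda>n. ennreal (measure (P x) {\<omega> \<in> space (P x). enat n < exit_time K (\<lambda>k. S k \<omega>)}
            powr (1 / real n)))
      \<longlonglongrightarrow> laplace_transform \<mu> xstar"
proof
  fix x assume x: "x \<in> shift_along K v \<delta>"
  interpret random_increments \<mu>
    using assms(5,6) by (simp add: random_increments_def random_increments_axioms_def)
  have K_borel[measurable]: "K \<in> sets borel"
    using \<open>closed K\<close> by (rule borel_closed)
  have int: "integrable \<mu> (\<lambda>y. exp (z \<bullet> y))" if "z \<in> V" for z
    using laplace_finite[OF that] by (simp add: integrable_exp_inner_iff)
  note L = mgf_pos[OF int[OF \<open>xstar \<in> V\<close>]]
  have min: "mgf xstar \<le> mgf z" if "z \<in> dual_cone K \<inter> V" for z
    using laplace_min[OF that] laplace_transform_eq_mgf[OF int] that \<open>xstar \<in> V\<close> mgf_pos[OF int, of z]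
    by (simp add: ennreal_le_iff)
  obtain n0 where start: "measure paths
      {\<omega>. (\<forall>k\<in>{1..n0}. position k \<omega> + \<delta> *\<^sub>R v \<in> K) \<and> position n0 \<omega> \<in> interior K} > 0"
  proof -
    have "{y \<in> space borel. y - (- \<delta>) *\<^sub>R v \<in> K} \<in> sets borel"
      by measurable
    then have "shift_along K v (- \<delta>) \<in> sets borel"
      by (simp add: mem_shift_along_iff[symmetric] del: scaleR_minus_left diff_minus_eq_add)
    from random_walk_prob_stay[OF walk this, of "interior K" 0] assms(15) that show thesis
      by (auto simp: mem_shift_along_iff)
  qed
  let ?a = "\<lambda>n. measure paths {\<omega>. \<forall>k\<in>{1..n}. x + position k \<omega> \<in> K}"
  have stay: "measure (P x) {\<omega> \<in> space (P x). enat n < exit_time K (\<lambda>k. S k \<omega>)} = ?a n" for n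
    using random_walk_prob_stay[OF walk K_borel, of UNIV x n] by simp
  have xK: "x - \<delta> *\<^sub>R v \<in> K"
    using x by (simp add: mem_shift_along_iff)
  have "\<delta> *\<^sub>R v \<in> K"
    using \<open>0 \<le> \<delta>\<close> \<open>v \<in> interior K\<close> interior_subset by (intro convex_cone_scaleR[OF \<open>convex_cone K\<close>]) auto
  from convex_cone_add[OF \<open>convex_cone K\<close> xK this] have "x \<in> K" by simp
  have "(\<lambda>n. ?a n powr (1 / real n)) \<longlonglongrightarrow> mgf xstar"
  proof (rule root_tendsto_of_exponential_bounds[OF L])
    show "?a n \<le> exp (xstar \<bullet> x) * mgf xstar ^ n" for n
      using \<open>closed K\<close> \<open>xstar \<in> dual_cone K\<close> \<open>x \<in> K\<close> int[OF \<open>xstar \<in> V\<close>] by (rule prob_stay_upper_bound)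
    fix t :: real assume "t > 0"
    define b where "b = mgf xstar * exp (- t)"
    have b: "b > 0" using L by (simp add: b_def)
    obtain N where N: "N \<ge> 1" "b ^ N < measure paths {\<omega>. position N \<omega> \<in> K}"
      using cone_visit_probability[OF assms(1,2,4) non_degenerate assms(9,11,10) laplace_finite min \<open>t > 0\<close>]
      unfolding b_def by blast
    \<comment> \<open>This allows rounding \<open>n\<close> down to a multiple of \<open>N\<close> in the exponent.\<close>
    have "b \<le> 1"
    proof (rule ccontr)
      assume "\<not> b \<le> 1"
      then have "1 \<le> b ^ N" by (simp add: one_le_power)
      with N(2) seq.P.prob_le_1 show False by (meson not_le order_trans)
    qed
    obtain c where c: "c > 0" and c_le: "\<And>n. c * (b ^ N) ^ (n div N)
        \<le> measure paths {\<omega>. \<forall>k\<in>{1..n}. position k \<omega> + \<delta> *\<^sub>R v \<in> K}"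
      using prob_stay_lower_bound[OF assms(1,2,4) \<open>0 \<le> \<delta>\<close> start N(1) zero_less_power[OF b] N(2)] by blast
    have "c * b ^ n \<le> ?a n" for n
    proof -
      have "b ^ n \<le> b ^ (N * (n div N))"
        using b \<open>b \<le> 1\<close> by (intro power_decreasing) auto
      then have "c * b ^ n \<le> c * (b ^ N) ^ (n div N)"
        using c by (simp add: power_mult)
      also note c_le[of n]
      also have "measure paths {\<omega>. \<forall>k\<in>{1..n}. position k \<omega> + \<delta> *\<^sub>R v \<in> K} \<le> ?a n"
      proof (rule seq.P.finite_measure_mono)
        show "{\<omega>. \<forall>k\<in>{1..n}. position k \<omega> + \<delta> *\<^sub>R v \<in> K} \<subseteq> {\<omega>. \<forall>k\<in>{1..n}. x + position k \<omega> \<in> K}"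
        proof safe
          fix \<omega> k assume "\<forall>k\<in>{1..n}. position k \<omega> + \<delta> *\<^sub>R v \<in> K" "k \<in> {1..n}"
          then have "(x - \<delta> *\<^sub>R v) + (position k \<omega> + \<delta> *\<^sub>R v) \<in> K"
            using convex_cone_add[OF \<open>convex_cone K\<close> xK] by blast
          then show "x + position k \<omega> \<in> K" by (simp add: algebra_simps)
        qed
        have "{\<omega> \<in> space paths. \<forall>k\<in>{1..n}. x + position k \<omega> \<in> K} \<in> sets paths"
          by measurable
        then show "{\<omega>. \<forall>k\<in>{1..n}. x + position k \<omega> \<in> K} \<in> sets paths" by simp
      qed
      finally show ?thesis .
    qed
    with c show "\<exists>c>0. \<forall>n. c * (mgf xstar * exp (- t)) ^ n \<le> ?a n"
      unfolding b_def by blast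
  qed simp
  then show "(\<lambda>n. ennreal (measure (P x) {\<omega> \<in> space (P x). enat n < exit_time K (\<lambda>k. S k \<omega>)}
      powr (1 / real n))) \<longlonglongrightarrow> laplace_transform \<mu> xstar"
    unfolding stay laplace_transform_eq_mgf[OF int[OF \<open>xstar \<in> V\<close>]] by (rule tendsto_ennrealI)
qed

end
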